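(* The space-decoupling parameterization $(\mathcal{M}_h,\phi)$ satisfies: (i) "$1\Rightarrow1$" holds at $(X,G)\in\mathcal{M}_h$ if and only if $\operatorname{rank}(X)=r$; (ii) "$2\Rightarrow1$" holds everywhere on $\mathcal{M}_h$.
   Context: Let $r\le\min\{m,n\}$ and $\mathbb{R}^{m\times n}_{\le r}=\{X\in\mathbb{R}^{m\times n}:\operatorname{rank}(X)\le r\}$. The map $h:\mathbb{R}^{m\times n}\to\mathbb{R}^q$ is smooth and orthogonally invariant, i.e. $h(XQ)=h(X)$ for all $X$ and all $Q\in\mathcal{O}(n)=\{Q\in\mathbb{R}^{n\times n}:Q^\top Q=I_n\}$. Put $\mathcal{H}=\{X\in\mathbb{R}^{m\times n}:h(X)=0\}$; it is assumed that the differential $\mathrm{D}h_X$ has rank $q$ for all $X\in\mathcal{H}$. $\mathrm{Sym}(n)$ is the space of symmetric $n\times n$ matrices and $\mathrm{Gr}(n,n-r)=\{G\in\mathrm{Sym}(n):G^2=G,\ \operatorname{rank}(G)=n-r\}$. The space-decoupling parameterization is the manifold $$\mathcal{M}_h=\{(X,G)\in\mathbb{R}^{m\times n}\times\mathrm{Gr}(n,n-r):\ XG=0,\ h(X)=0\},$$ an embedded submanifold of $\mathbb{R}^{m\times n}\times\mathrm{Sym}(n)$, together with the map $\phi(X,G)=X$, which satisfies $\phi(\mathcal{M}_h)=\mathbb{R}^{m\times n}_{\le r}\cap\mathcal{H}$. For a twice continuously differentiable $f:\mathbb{R}^{m\times n}\to\mathbb{R}$ consider the original problem: minimize $f$ over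 $\mathbb{R}^{m\times n}_{\le r}\cap\mathcal{H}$; and the reformulated problem: minimize $\bar f=f\circ\phi$ over $\mathcal{M}_h$. A point $X\in\mathbb{R}^{m\times n}_{\le r}\cap\mathcal{H}$ is (first-order) stationary for the original problem if $\langle\nabla f(X),\eta\rangle\ge0$ for all $\eta$ in the Bouligand tangent cone $\mathrm{T}_X(\mathbb{R}^{m\times n}_{\le r}\cap\mathcal{H})$, where $\mathrm{T}_X\mathcal{X}=\{\lim_k (X_k-X)/t_k:\ X_k\in\mathcal{X},\ t_k>0,\ t_k\to0\}$. A point $(X,G)\in\mathcal{M}_h$ is first-order stationary for the reformulated problem if $\mathrm{D}\bar f_{(X,G)}[\eta,\zeta]=0$ for all $(\eta,\zeta)\in\mathrm{T}_{(X,G)}\mathcal{M}_h$; it is second-order stationary if in addition $(\bar f\circ\gamma)''(0)\ge0$ for all (smooth) curves $\gamma$ on $\mathcal{M}_h$ with $\gamma(0)=(X,G)$. For $k\in\{1,2\}$, "$k\Rightarrow1$" holds at $(X,G)\in\mathcal{M}_h$ if, for any twice continuously differentiable objective function $f:\mathbb{R}^{m\times n}\to\mathbb{R}$, $(X,G)$ being $k$-th-order stationary for the reformulated problem implies that $\phi(X,G)$ is first-order stationary for the original problem.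
   Formalization: The "only if" half of (i) is stated for r < n: for r = n it fails, e.g. m = n = r = 2, h(X) = ‖X‖² − 1, where φ is a diffeomorphism onto the feasible set and "1⇒1" holds at the rank-one point E₁₁. Dimensions m, n, q are at least 1. *)

theory Defs
  imports "HOL-Analysis.Analysis"
begin

section \<open>Differentiability classes on open sets\<close>

text \<open>
  \<open>Ck_on k f S\<close> is only meaningful for open \<open>S\<close>. On a finite-dimensional domain, asking that every
  directional derivative \<open>\<lambda>x. D f x v\<close> be of class \<open>C^k\<close> is the same as asking that \<open>D f\<close> be so.
\<close>

fun Ck_on :: "nat \<Rightarrow> ('a::real_normed_vector \<Rightarrow> 'b::real_normed_vector) \<Rightarrow> 'a set \<Rightarrow> bool" where
  "Ck_on 0 f S \<longleftrightarrow> continuous_on S f"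
| "Ck_on (Suc k) f S \<longleftrightarrow> (\<forall>x\<in>S. f differentiable (at x)) \<and>
     (\<forall>v. Ck_on k (\<lambda>x. frechet_derivative f (at x) v) S)"

definition smooth_on :: "('a::real_normed_vector \<Rightarrow> 'b::real_normed_vector) \<Rightarrow> 'a set \<Rightarrow> bool" where
  "smooth_on f S \<longleftrightarrow> (\<forall>k. Ck_on k f S)"

definition gradient :: "('a::real_inner \<Rightarrow> real) \<Rightarrow> 'a \<Rightarrow> 'a" where
  "gradient f x = (THE g. GDERIV f x :> g)"

text \<open>The Bouligand tangent cone. At a point of an embedded submanifold it is the tangent space.\<close>

definition tangent_cone :: "'a::real_normed_vector set \<Rightarrow> 'a \<Rightarrow> 'a set" where
  "tangent_cone S x = {\<eta>. \<exists>(X :: nat \<Rightarrow> 'a) (t :: nat \<Rightarrow> real).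
     (\<forall>k. X k \<in> S) \<and> (\<forall>k. t k > 0) \<and> t \<longlonglongrightarrow> 0 \<and> (\<lambda>k. (X k - x) /\<^sub>R t k) \<longlonglongrightarrow> \<eta>}"

section \<open>The feasible sets\<close>

definition orthogonally_invariant :: "(real^'n^'m \<Rightarrow> 'b) \<Rightarrow> bool" where
  "orthogonally_invariant h \<longleftrightarrow> (\<forall>X (Q :: real^'n^'n). orthogonal_matrix Q \<longrightarrow> h (X ** Q) = h X)"

definition bounded_rank :: "nat \<Rightarrow> (real^'n^'m) set" where
  "bounded_rank r = {X. rank X \<le> r}"

definition zero_set :: "('a \<Rightarrow> 'b::zero) \<Rightarrow> 'a set" where
  "zero_set h = {X. h X = 0}"

text \<open>Points of the Grassmannian \<open>Gr(n, k)\<close> are the orthogonal projectors of rank \<open>k\<close>.\<close>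

definition Gr :: "nat \<Rightarrow> (real^'n^'n) set" where
  "Gr k = {G. transpose G = G \<and> G ** G = G \<and> rank G = k}"

text \<open>
  The space \<open>Sym(n)\<close> is not a type of its own: \<open>M_h\<close> lives in \<open>\<real>^{m\<times>n} \<times> \<real>^{n\<times>n}\<close>. Since
  \<open>Sym(n)\<close> is a closed subspace, tangent vectors of \<open>M_h\<close> and velocities of curves on it still
  have their second component in \<open>Sym(n)\<close>.

  If \<open>r = n\<close>, then \<open>Gr(n, n - r) = {0}\<close> and \<open>\<phi>\<close> identifies \<open>M_h\<close> with the manifold \<open>zero_set h\<close>,
  rank-deficient points included.
\<close>

definition M_h :: "nat \<Rightarrow> (real^'n^'m \<Rightarrow> 'b::zero) \<Rightarrow> ((real^'n^'m) \<times> (real^'n^'n)) set" where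
  "M_h r h = {(X, G). G \<in> Gr (CARD('n) - r) \<and> X ** G = 0 \<and> h X = 0}"

definition \<phi> :: "(real^'n^'m) \<times> (real^'n^'n) \<Rightarrow> real^'n^'m" where
  "\<phi> = (\<lambda>(X, G). X)"

section \<open>Stationarity\<close>

definition stationary_original ::
  "nat \<Rightarrow> (real^'n^'m \<Rightarrow> 'b::zero) \<Rightarrow> (real^'n^'m \<Rightarrow> real) \<Rightarrow> real^'n^'m \<Rightarrow> bool" where
  "stationary_original r h f X \<longleftrightarrow> X \<in> bounded_rank r \<inter> zero_set h \<and>
     (\<forall>\<eta> \<in> tangent_cone (bounded_rank r \<inter> zero_set h) X. gradient f X \<bullet> \<eta> \<ge> 0)"

text \<open>
  \<open>f \<circ> \<phi>\<close> is defined on the whole ambient space; its differential there restricts to the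
  differential of the cost function on \<open>M_h\<close> along tangent vectors of \<open>M_h\<close>.
\<close>

definition stationary1_reformulated ::
  "nat \<Rightarrow> (real^'n^'m \<Rightarrow> 'b::zero) \<Rightarrow> (real^'n^'m \<Rightarrow> real) \<Rightarrow> (real^'n^'m) \<times> (real^'n^'n) \<Rightarrow> bool" where
  "stationary1_reformulated r h f p \<longleftrightarrow> p \<in> M_h r h \<and>
     (\<forall>v \<in> tangent_cone (M_h r h) p. frechet_derivative (f \<circ> \<phi>) (at p) v = 0)"

definition smooth_curve_at :: "'a::real_normed_vector set \<Rightarrow> 'a \<Rightarrow> (real \<Rightarrow> 'a) \<Rightarrow> bool" where
  "smooth_curve_at S p \<gamma> \<longleftrightarrow>
     (\<exists>\<epsilon>>0. smooth_on \<gamma> {-\<epsilon><..<\<epsilon>} \<and> \<gamma> ` {-\<epsilon><..<\<epsilon>} \<subseteq> S) \<and> \<gamma> 0 = p"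

definition stationary2_reformulated ::
  "nat \<Rightarrow> (real^'n^'m \<Rightarrow> 'b::zero) \<Rightarrow> (real^'n^'m \<Rightarrow> real) \<Rightarrow> (real^'n^'m) \<times> (real^'n^'n) \<Rightarrow> bool" where
  "stationary2_reformulated r h f p \<longleftrightarrow> stationary1_reformulated r h f p \<and>
     (\<forall>\<gamma>. smooth_curve_at (M_h r h) p \<gamma> \<longrightarrow> deriv (deriv (f \<circ> \<phi> \<circ> \<gamma>)) 0 \<ge> 0)"

definition one_implies_one ::
  "nat \<Rightarrow> (real^'n^'m \<Rightarrow> 'b::zero) \<Rightarrow> (real^'n^'m) \<times> (real^'n^'n) \<Rightarrow> bool" where
  "one_implies_one r h p \<longleftrightarrow> (\<forall>f. Ck_on 2 f UNIV \<longrightarrow>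
     stationary1_reformulated r h f p \<longrightarrow> stationary_original r h f (\<phi> p))"

definition two_implies_one ::
  "nat \<Rightarrow> (real^'n^'m \<Rightarrow> 'b::zero) \<Rightarrow> (real^'n^'m) \<times> (real^'n^'n) \<Rightarrow> bool" where
  "two_implies_one r h p \<longleftrightarrow> (\<forall>f. Ck_on 2 f UNIV \<longrightarrow>
     stationary2_reformulated r h f p \<longrightarrow> stationary_original r h f (\<phi> p))"

end

theory Submission
  imports Defs
begin

text \<open>
  The argument rests on one consequence of orthogonal invariance. If \<open>X v = 0\<close> for a unit vector
  \<open>v\<close>, the reflection \<open>I - 2 v v\<^sup>T\<close> fixes \<open>X\<close> and reverses every rank-one direction \<open>u v\<^sup>T\<close>; since
  \<open>h\<close> does not see the reflection, \<open>D h\<^sub>X (u v\<^sup>T) = 0\<close>. So all normals of the level set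
  \<open>{h = 0}\<close> at \<open>X\<close> have their rows in the row space of \<open>X\<close>. Given a direction \<open>\<eta>\<close> with
  \<open>D h\<^sub>X \<eta> = 0\<close>, the curve \<open>X + t \<eta>\<close> can be pushed back to \<open>{h = 0}\<close> along these normals, and the
  correction never enlarges the row space beyond that of \<open>X\<close> and \<open>\<eta>\<close> (\<open>feasible_curve\<close>). This is
  what decouples the rank constraint from \<open>h\<close>. The corrected curve must be smooth, which needs the
  implicit function theorem in class \<open>C\<^sup>\<infinity>\<close> (\<open>smooth_curve_in_level_set\<close>).

  If \<open>rank X = r\<close>, then \<open>G\<close> is the projector onto the kernel of \<open>X\<close>, and it depends on \<open>X\<close> in a
  Lipschitz way: for feasible \<open>X\<^sub>k \<longlonglongrightarrow> X\<close> and projectors \<open>G\<^sub>k\<close> of the same rank with \<open>X\<^sub>k G\<^sub>k = 0\<close>,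
  \<open>X (I - G) G\<^sub>k = - (X\<^sub>k - X) G\<^sub>k\<close> bounds \<open>(I - G) G\<^sub>k\<close>, and for projectors of equal rank this
  controls \<open>G\<^sub>k - G\<close> (\<open>norm_diff_projectors\<close>). By compactness every tangent direction of the original
  feasible set lifts to one of \<open>M_h\<close> (\<open>tangent_cone_lift\<close>), so first-order stationarity transfers.

  If \<open>rank X < r\<close>, take \<open>u\<close> orthogonal to the range of \<open>X\<close> and \<open>v\<close> in the range of \<open>G\<close>. The linear
  function \<open>f(Y) = u\<^sup>T Y v\<close> is stationary on \<open>M_h\<close>, because differentiating \<open>X G = 0\<close> gives
  \<open>u\<^sup>T \<eta> G = 0\<close> for tangent directions; but \<open>- u v\<^sup>T\<close> is a descent direction that is tangent to the
  original feasible set, since one more rank is still available. Hence "1 implies 1" fails.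

  For "2 implies 1" with \<open>rank X < r\<close>, there is a unit vector \<open>w\<close> in the kernel of \<open>X\<close> orthogonal to
  the range of \<open>G\<close>. Follow a feasible curve \<open>Y(t)\<close> in the direction \<open>u w\<^sup>T\<close> and at the same time rotate
  the plane of \<open>v\<close> and \<open>w\<close> with angular speed \<open>\<alpha>\<close>. The second derivative of \<open>f\<close> along this curve is
  \<open>c + 2 \<alpha> D f\<^sub>X (u v\<^sup>T)\<close>, where \<open>c\<close> does not depend on \<open>\<alpha>\<close>. It is nonnegative for every real \<open>\<alpha>\<close>,
  so \<open>D f\<^sub>X (u v\<^sup>T) = 0\<close> (\<open>derivative_along_moving_kernel_eq_0\<close>). Together with first-order
  stationarity along curves on which \<open>G\<close> is constant, \<open>D f\<^sub>X\<close> vanishes on the whole kernel of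
  \<open>D h\<^sub>X\<close>, which contains the tangent cone of the original feasible set.
\<close>

section \<open>Functions of class \<open>C^k\<close>\<close>

lemmas Ck_on_Suc = Ck_on.simps(2)

(* Automatic unfolding would replace every smoothness goal by one about all directional
   derivatives, where the closure rules below no longer apply. *)
declare Ck_on_Suc [simp del]

lemma Ck_on_cong:
  assumes "open S" "\<And>x. x \<in> S \<Longrightarrow> f x = g x" "Ck_on k f S"
  shows "Ck_on k g S"
  using assms
proof (induction k arbitrary: f g)
  case 0
  then show ?case using continuous_on_cong[of S S f g] by simp
next
  case (Suc k)
  note [simp] = Ck_on_Suc
  have der: "(g has_derivative frechet_derivative f (at x)) (at x)" if "x \<in> S" for x
    using Suc.prems that
    by (intro has_derivative_transform_within_open[of f _ x UNIV S g])
       (auto simp: frechet_derivative_works[symmetric])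
  have "frechet_derivative f (at x) = frechet_derivative g (at x)" if "x \<in> S" for x
    using frechet_derivative_at[OF der[OF that]] .
  then have "Ck_on k (\<lambda>x. frechet_derivative g (at x) v) S" for v
    using Suc.IH[of "\<lambda>x. frechet_derivative f (at x) v" "\<lambda>x. frechet_derivative g (at x) v"]
      Suc.prems by simp
  then show ?case using der by (auto simp: differentiable_def)
qed

lemma Ck_on_SucI:
  assumes "open S" "\<And>x. x \<in> S \<Longrightarrow> (f has_derivative f' x) (at x)"
    and "\<And>v. Ck_on k (\<lambda>x. f' x v) S"
  shows "Ck_on (Suc k) f S"
proof -
  have eq: "f' x = frechet_derivative f (at x)" if "x \<in> S" for x
    using frechet_derivative_at[OF assms(2)[OF that]] .
  have "Ck_on k (\<lambda>x. frechet_derivative f (at x) v) S" for v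
    by (rule Ck_on_cong[OF assms(1) _ assms(3)[of v]]) (simp add: eq)
  then show ?thesis using assms(2) by (auto simp: differentiable_def Ck_on_Suc)
qed

lemma Ck_on_SucD: "Ck_on (Suc k) f S \<Longrightarrow> Ck_on k f S"
proof (induction k arbitrary: f)
  case 0
  then show ?case
    unfolding Ck_on.simps(1) Ck_on_Suc
    by (intro differentiable_imp_continuous_on) (simp add: differentiable_on_def differentiable_at_withinI)
next
  case (Suc k)
  have "Ck_on k (\<lambda>x. frechet_derivative f (at x) v) S" for v
    using Suc.prems Suc.IH unfolding Ck_on_Suc[of "Suc k"] by blast
  with Suc.prems show ?case unfolding Ck_on_Suc by blast
qed

lemma Ck_on_continuous: "Ck_on k f S \<Longrightarrow> continuous_on S f"
  by (induction k) (auto dest: Ck_on_SucD)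

lemma Ck_on_Suc_has_derivative:
  "Ck_on (Suc k) f S \<Longrightarrow> x \<in> S \<Longrightarrow> (f has_derivative frechet_derivative f (at x)) (at x)"
  by (simp add: frechet_derivative_works[symmetric] Ck_on_Suc)

lemma smooth_on_differentiable:
  assumes "smooth_on h S" "x \<in> S"
  shows "h differentiable (at x)"
proof -
  have "Ck_on (Suc 0) h S" using assms(1) unfolding smooth_on_def by blast
  then show ?thesis using assms(2) by (simp add: Ck_on_Suc)
qed

lemma Ck_on_const: "open S \<Longrightarrow> Ck_on k (\<lambda>_. c) S"
proof (induction k arbitrary: c)
  case (Suc k)
  show ?case by (rule Ck_on_SucI[where f' = "\<lambda>_ _. 0"]) (use Suc in auto)
qed simp

lemma Ck_on_linear:
  assumes "bounded_linear L" "open S"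
  shows "Ck_on k L S"
proof (cases k)
  case 0
  then show ?thesis using assms linear_continuous_on by auto
next
  case (Suc j)
  show ?thesis unfolding Suc
    by (rule Ck_on_SucI[where f' = "\<lambda>_. L"])
       (use assms bounded_linear_imp_has_derivative Ck_on_const in auto)
qed

lemma Ck_on_add:
  assumes "open S" "Ck_on k f S" "Ck_on k g S"
  shows "Ck_on k (\<lambda>x. f x + g x) S"
  using assms
proof (induction k arbitrary: f g)
  case (Suc k)
  show ?case
    by (rule Ck_on_SucI[where
          f' = "\<lambda>x v. frechet_derivative f (at x) v + frechet_derivative g (at x) v"])
      (use Suc in \<open>auto intro!: has_derivative_add Ck_on_Suc_has_derivative simp: Ck_on_Suc\<close>)
qed (auto intro: continuous_intros)

lemma Ck_on_sum:
  assumes "open S" "\<And>i. i \<in> I \<Longrightarrow> Ck_on k (f i) S"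
  shows "Ck_on k (\<lambda>x. \<Sum>i\<in>I. f i x) S"
  using assms(2)
  by (induction I rule: infinite_finite_induct) (auto intro!: Ck_on_const Ck_on_add assms(1))

lemma Ck_on_bilinear:
  assumes B: "bounded_bilinear B" and "open S" "Ck_on k f S" "Ck_on k g S"
  shows "Ck_on k (\<lambda>x. B (f x) (g x)) S"
  using assms(2-)
proof (induction k arbitrary: f g)
  case 0
  then show ?case using bounded_bilinear.continuous_on[OF B] by auto
next
  case (Suc k)
  show ?case
  proof (rule Ck_on_SucI[OF \<open>open S\<close>])
    show "((\<lambda>x. B (f x) (g x)) has_derivative
        (\<lambda>v. B (f x) (frechet_derivative g (at x) v) + B (frechet_derivative f (at x) v) (g x))) (at x)"
      if "x \<in> S" for x
      by (intro bounded_bilinear.FDERIV[OF B] Ck_on_Suc_has_derivative) (fact Suc.prems that)+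
    show "Ck_on k (\<lambda>x. B (f x) (frechet_derivative g (at x) v) +
        B (frechet_derivative f (at x) v) (g x)) S" for v
      using Suc.prems Suc.prems(2,3)[THEN Ck_on_SucD]
      by (intro Ck_on_add Suc.IH) (auto simp: Ck_on_Suc)
  qed
qed

lemma Ck_on_bounded_linear:
  assumes L: "bounded_linear L" and "open S" "Ck_on k f S"
  shows "Ck_on k (\<lambda>x. L (f x)) S"
  using assms(2-)
proof (induction k arbitrary: f)
  case 0
  then show ?case using bounded_linear.continuous_on[OF L] by auto
next
  case (Suc k)
  show ?case
    by (rule Ck_on_SucI[where f' = "\<lambda>x v. L (frechet_derivative f (at x) v)"])
      (use Suc in \<open>auto intro!: bounded_linear.has_derivative[OF L] Ck_on_Suc_has_derivative simp: Ck_on_Suc\<close>)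
qed

lemma Ck_on_euclideanI:
  fixes f :: "'a::real_normed_vector \<Rightarrow> 'b::euclidean_space"
  assumes "open S" "\<And>b. b \<in> Basis \<Longrightarrow> Ck_on k (\<lambda>x. f x \<bullet> b) S"
  shows "Ck_on k f S"
proof -
  have "Ck_on k (\<lambda>x. \<Sum>b\<in>Basis. (f x \<bullet> b) *\<^sub>R b) S"
    using assms by (intro Ck_on_sum Ck_on_bounded_linear[of "\<lambda>c. c *\<^sub>R _"] bounded_linear_scaleR_left)
  then show ?thesis by (simp add: euclidean_representation)
qed

text \<open>
  By the chain rule the directional derivative of \<open>f \<circ> g\<close> is \<open>D f (g x) (D g x v)\<close>. Expanding the
  moving direction \<open>D g x v\<close> in a basis turns this into products of functions of lower order, to
  which the induction hypothesis applies.
\<close>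

lemma Ck_on_compose:
  fixes f :: "'b::euclidean_space \<Rightarrow> 'c::real_normed_vector"
  assumes "open S" "open T" "g ` T \<subseteq> S" "Ck_on k f S" "Ck_on k g T"
  shows "Ck_on k (\<lambda>x. f (g x)) T"
  using assms(4-)
proof (induction k arbitrary: f)
  case 0
  then show ?case using continuous_on_compose2 assms(3) by auto
next
  case (Suc k)
  show ?case
  proof (rule Ck_on_SucI[OF \<open>open T\<close>])
    show "((\<lambda>x. f (g x)) has_derivative
        (\<lambda>v. \<Sum>b\<in>Basis. (frechet_derivative g (at x) v \<bullet> b) *\<^sub>R frechet_derivative f (at (g x)) b)) (at x)"
      if "x \<in> T" for x
    proof -
      have f: "(f has_derivative frechet_derivative f (at (g x))) (at (g x))"
        using Suc.prems assms(3) that by (intro Ck_on_Suc_has_derivative) auto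
      interpret linear "frechet_derivative f (at (g x))" using has_derivative_linear[OF f] .
      have "frechet_derivative f (at (g x)) w =
          (\<Sum>b\<in>Basis. (w \<bullet> b) *\<^sub>R frechet_derivative f (at (g x)) b)" for w
        by (metis (no_types, lifting) euclidean_representation scale sum sum.cong)
      then have "frechet_derivative f (at (g x)) = (\<lambda>w. \<Sum>b\<in>Basis. (w \<bullet> b) *\<^sub>R frechet_derivative f (at (g x)) b)"
        by (rule ext)
      note expand = fun_cong[OF this]
      show ?thesis
        using has_derivative_compose[OF Ck_on_Suc_has_derivative[OF Suc.prems(2) that] f]
        by (subst (asm) expand)
    qed
    show "Ck_on k (\<lambda>x. \<Sum>b\<in>Basis. (frechet_derivative g (at x) v \<bullet> b) *\<^sub>R
        frechet_derivative f (at (g x)) b) T" for v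
    proof (rule Ck_on_sum[OF \<open>open T\<close>])
      fix b :: 'b assume "b \<in> Basis"
      have "Ck_on k (\<lambda>x. frechet_derivative g (at x) v \<bullet> b) T"
        using Suc.prems(2) assms(2)
        by (intro Ck_on_bounded_linear[OF bounded_linear_inner_left]) (simp_all add: Ck_on_Suc)
      moreover have "Ck_on k (\<lambda>x. frechet_derivative f (at (g x)) b) T"
        using Suc.prems(1) Ck_on_SucD[OF Suc.prems(2)] by (intro Suc.IH) (simp_all add: Ck_on_Suc)
      ultimately show "Ck_on k (\<lambda>x. (frechet_derivative g (at x) v \<bullet> b) *\<^sub>R
          frechet_derivative f (at (g x)) b) T"
        using Ck_on_bilinear[OF bounded_bilinear_scaleR assms(2)] by blast
    qed
  qed
qed

lemma Ck_on_Pair: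
  assumes "open S" "Ck_on k f S" "Ck_on k g S"
  shows "Ck_on k (\<lambda>x. (f x, g x)) S"
proof -
  have "Ck_on k (\<lambda>x. (f x, 0)) S" "Ck_on k (\<lambda>x. (0, g x)) S"
    by (rule Ck_on_bounded_linear[OF bounded_linear_Pair[OF bounded_linear_ident bounded_linear_zero] assms(1,2)])
       (rule Ck_on_bounded_linear[OF bounded_linear_Pair[OF bounded_linear_zero bounded_linear_ident] assms(1,3)])
  from Ck_on_add[OF assms(1) this] show ?thesis by simp
qed

text \<open>
  Here the derivative contains the function itself: \<open>D (1/f) = - (1/f) (D f) (1/f)\<close>. The product
  rule then makes \<open>1/f\<close> one order smoother than what is already known about it.
\<close>

lemma Ck_on_inverse:
  fixes f :: "'a::real_normed_vector \<Rightarrow> real"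
  assumes "open S" "\<And>x. x \<in> S \<Longrightarrow> f x \<noteq> 0" "Ck_on k f S"
  shows "Ck_on k (\<lambda>x. inverse (f x)) S"
  using assms(3)
proof (induction k)
  case 0
  then show ?case using assms(2) by (auto intro: continuous_intros)
next
  case (Suc k)
  show ?case
  proof (rule Ck_on_SucI[OF \<open>open S\<close>])
    show "((\<lambda>x. inverse (f x)) has_derivative
        (\<lambda>v. - (inverse (f x) * frechet_derivative f (at x) v * inverse (f x)))) (at x)"
      if "x \<in> S" for x
      using Ck_on_Suc_has_derivative[OF Suc.prems that] assms(2)[OF that]
      by (intro Deriv.has_derivative_inverse) auto
    show "Ck_on k (\<lambda>x. - (inverse (f x) * frechet_derivative f (at x) v * inverse (f x))) S" for v
      using Suc.prems Suc.IH[OF Ck_on_SucD] assms(1)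
      by (intro Ck_on_bounded_linear[of uminus] Ck_on_bilinear[OF bounded_bilinear_mult])
        (auto intro: bounded_linear_minus bounded_linear_ident simp: Ck_on_Suc)
  qed
qed

lemma Ck_on_det:
  fixes A :: "'a::real_normed_vector \<Rightarrow> real^'q^'q"
  assumes "open S" "\<And>i j. Ck_on k (\<lambda>x. A x $ i $ j) S"
  shows "Ck_on k (\<lambda>x. det (A x)) S"
proof -
  have "Ck_on k (\<lambda>x. \<Prod>i\<in>I. A x $ i $ p i) S" for I :: "'q set" and p
    by (induction I rule: infinite_finite_induct)
      (auto intro!: Ck_on_const Ck_on_bilinear[OF bounded_bilinear_mult] assms)
  then show ?thesis unfolding det_def
    by (intro Ck_on_sum[OF assms(1)] Ck_on_bounded_linear[OF bounded_linear_mult_right assms(1)])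
qed

text \<open>
  Cramer's rule makes the solution of a linear system a rational function of its data, so it
  inherits their smoothness.
\<close>

lemma Ck_on_linear_system_solution:
  fixes A :: "'a::real_normed_vector \<Rightarrow> real^'q^'q"
  assumes S: "open S" and A: "\<And>i j. Ck_on k (\<lambda>x. A x $ i $ j) S" and b: "\<And>i. Ck_on k (\<lambda>x. b x $ i) S"
    and d: "\<And>x. x \<in> S \<Longrightarrow> det (A x) \<noteq> 0" and sol: "\<And>x. x \<in> S \<Longrightarrow> A x *v y x = b x"
  shows "Ck_on k y S"
proof (rule Ck_on_euclideanI[OF S])
  fix e :: "real^'q" assume "e \<in> Basis"
  then obtain l where e: "e = axis l 1" by (auto simp: Basis_vec_def)
  define N where "N x = (\<chi> i j. if j = l then b x $ i else A x $ i $ j)" for x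
  have "Ck_on k (\<lambda>x. N x $ i $ j) S" for i j
    using A b by (cases "j = l") (simp_all add: N_def)
  then have "Ck_on k (\<lambda>x. det (N x) * inverse (det (A x))) S"
    using Ck_on_bilinear[OF bounded_bilinear_mult S Ck_on_det[OF S]
        Ck_on_inverse[OF S d Ck_on_det[OF S A]]] by blast
  then show "Ck_on k (\<lambda>x. y x \<bullet> e) S"
  proof (rule Ck_on_cong[OF S, rotated])
    fix x assume x: "x \<in> S"
    have "y x = (\<chi> k. det (\<chi> i j. if j = k then b x $ i else A x $ i $ j) / det (A x))"
      using cramer[OF d[OF x], of "y x" "b x"] sol[OF x] by simp
    then show "det (N x) * inverse (det (A x)) = y x \<bullet> e"
      by (simp add: e inner_axis N_def divide_inverse)
  qed
qed

lemma Ck_on_sin_cos: "open S \<Longrightarrow> Ck_on k (\<lambda>t::real. c * cos (\<alpha> * t) + d * sin (\<alpha> * t)) S"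
proof (induction k arbitrary: c d)
  case 0
  show ?case unfolding Ck_on.simps(1) by (intro continuous_intros)
next
  case (Suc k)
  show ?case
  proof (rule Ck_on_SucI[OF \<open>open S\<close>])
    show "((\<lambda>t. c * cos (\<alpha> * t) + d * sin (\<alpha> * t)) has_derivative
       (\<lambda>v. v *\<^sub>R ((\<alpha> * d) * cos (\<alpha> * t) + (- \<alpha> * c) * sin (\<alpha> * t)))) (at t)" for t
      by (auto intro!: derivative_eq_intros simp: fun_eq_iff algebra_simps)
    show "Ck_on k (\<lambda>t. v *\<^sub>R ((\<alpha> * d) * cos (\<alpha> * t) + (- \<alpha> * c) * sin (\<alpha> * t))) S" for v
      by (intro Ck_on_bounded_linear[OF bounded_linear_scaleR_right] Suc)
  qed
qed

section \<open>Smooth curves in a regular level set\<close>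

text \<open>
  The implicit function theorem for curves. At a regular point the normal space of the level set is
  the range of the adjoint of \<open>D h\<close>, and moving along it corrects the value of \<open>h\<close>. So the equation
  \<open>h (x + t \<eta> + A c) = 0\<close>, with \<open>A\<close> the adjoint, can be solved for \<open>c\<close> as a function of \<open>t\<close>. That the
  correction stays in the range of \<open>A\<close> matters as much as its existence: it is how the curve is kept
  within a bounded rank later on.
\<close>

lemma smooth_curve_in_level_set:
  fixes h :: "'a::euclidean_space \<Rightarrow> real^'q"
  assumes h: "smooth_on h UNIV" and hx: "h x = 0"
    and surj: "range (frechet_derivative h (at x)) = UNIV"
    and \<eta>: "frechet_derivative h (at x) \<eta> = 0"
  obtains \<epsilon> Y where "\<epsilon> > 0" "smooth_on Y {-\<epsilon><..<\<epsilon>}" "Y 0 = x" "(Y has_vector_derivative \<eta>) (at 0)"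
    "\<And>t. t \<in> {-\<epsilon><..<\<epsilon>} \<Longrightarrow> h (Y t) = 0"
    "\<And>t. t \<in> {-\<epsilon><..<\<epsilon>} \<Longrightarrow> Y t - x - t *\<^sub>R \<eta> \<in> range (adjoint (frechet_derivative h (at x)))"
proof -
  define D where "D y = frechet_derivative h (at y)" for y
  define A where "A = adjoint (D x)"
  have Ckh: "Ck_on k h UNIV" for k using h by (simp add: smooth_on_def)
  have D: "(h has_derivative D y) (at y)" for y
    unfolding D_def by (rule Ck_on_Suc_has_derivative[OF Ckh]) simp
  have linD: "linear (D y)" for y using has_derivative_linear[OF D] .
  have CkD: "Ck_on k (\<lambda>y. D y w) UNIV" for k w
    using Ckh[of "Suc k"] by (simp add: Ck_on_Suc D_def)
  have adj: "w \<bullet> A d = D x w \<bullet> d" for w d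
    unfolding A_def by (rule adjoint_works[OF linD])
  have linA: "linear A" unfolding A_def by (rule adjoint_linear[OF linD])
  then have blA: "bounded_linear A" by (simp add: linear_conv_bounded_linear)
  \<comment> \<open>\<open>D A\<close> is injective since \<open>D\<close> is onto; this makes the derivative of \<open>\<Phi>\<close> below invertible at the
     origin.\<close>
  have inj0: "d = 0" if "D x (A d) = 0" for d
  proof -
    have "A d \<bullet> A d = 0" using adj[of "A d" d] that by simp
    then have "D x w \<bullet> d = 0" for w using adj[of w d] by simp
    moreover obtain w where "D x w = d" using surj unfolding D_def by (metis UNIV_I imageE)
    ultimately show "d = 0" by (metis inner_eq_zero_iff)
  qed

  define P where "P t c = x + t *\<^sub>R \<eta> + A c" for t c
  define \<Phi> where "\<Phi> = (\<lambda>(t, c). (t, h (P t c)))"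
  define \<Phi>' where "\<Phi>' p = Blinfun (\<lambda>(s, d). (s, D (P (fst p) (snd p)) (s *\<^sub>R \<eta> + A d)))" for p
  have derP: "((\<lambda>p. P (fst p) (snd p)) has_derivative (\<lambda>q. fst q *\<^sub>R \<eta> + A (snd q))) (at p)" for p
    unfolding P_def
    by (auto intro!: derivative_eq_intros bounded_linear.has_derivative[OF blA])
  have der\<Phi>: "(\<Phi> has_derivative (\<lambda>(s, d). (s, D (P (fst p) (snd p)) (s *\<^sub>R \<eta> + A d)))) (at p)" for p
    unfolding \<Phi>_def case_prod_beta
    by (intro has_derivative_Pair has_derivative_compose[OF derP D] derivative_intros)
  have \<Phi>': "blinfun_apply (\<Phi>' p) = (\<lambda>(s, d). (s, D (P (fst p) (snd p)) (s *\<^sub>R \<eta> + A d)))" for p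
    unfolding \<Phi>'_def
    by (rule bounded_linear_Blinfun_apply) (rule has_derivative_bounded_linear[OF der\<Phi>])
  have cont\<Phi>': "continuous_on UNIV \<Phi>'"
  proof (rule continuous_on_blinfun_componentwise)
    fix i :: "real \<times> (real^'q)"
    have "continuous_on UNIV (\<lambda>p. P (fst p) (snd p))"
      using derP by (meson differentiable_def differentiable_imp_continuous_on differentiable_on_def
          differentiable_at_withinI)
    with continuous_on_compose2[OF Ck_on_continuous[OF CkD]]
    have "continuous_on UNIV (\<lambda>p. D (P (fst p) (snd p)) (fst i *\<^sub>R \<eta> + A (snd i)))"
      by blast
    then show "continuous_on UNIV (\<lambda>p. blinfun_apply (\<Phi>' p) i)"
      unfolding \<Phi>' case_prod_beta by (intro continuous_intros)
  qed
  have P0: "P 0 0 = x" by (simp add: P_def linear_0[OF linA])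
  have "inj (blinfun_apply (\<Phi>' (0, 0)))"
    unfolding linear_injective_0[OF blinfun.bounded_linear_right[THEN bounded_linear.linear]]
    using inj0 by (auto simp: \<Phi>' P0 linear_add[OF linD] linear_0[OF linD] zero_prod_def)
  then obtain L where L: "linear L" "L \<circ> blinfun_apply (\<Phi>' (0, 0)) = id"
    using linear_injective_left_inverse blinfun.bounded_linear_right[THEN bounded_linear.linear] by blast
  have inv\<Phi>': "Blinfun L o\<^sub>L \<Phi>' (0, 0) = id_blinfun"
    using L by (auto intro!: blinfun_eqI simp: bounded_linear_Blinfun_apply linear_conv_bounded_linear fun_eq_iff)
  have der\<Phi>': "(\<Phi> has_derivative blinfun_apply (\<Phi>' p)) (at p)" for p
    unfolding \<Phi>' by (rule der\<Phi>)
  obtain U V g g' where UV: "(0,0) \<in> U" "open V" "\<Phi> (0, 0) \<in> V" "homeomorphism U V \<Phi> g"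
    and g: "\<And>y. y \<in> V \<Longrightarrow> (g has_derivative g' y) (at y)"
    and bij: "\<And>y. y \<in> V \<Longrightarrow> bij (blinfun_apply (\<Phi>' (g y)))"
    by (rule inverse_function_theorem[OF open_UNIV der\<Phi>' cont\<Phi>' UNIV_I inv\<Phi>']) (rule that; assumption)
  have \<Phi>0: "\<Phi> (0, 0) = (0, 0)" using hx by (simp add: \<Phi>_def P0)
  have "open ((\<lambda>t. (t, 0)) -` V)" using UV(2) by (intro open_vimage continuous_intros)
  moreover have "0 \<in> (\<lambda>t. (t, 0)) -` V" using UV(3) \<Phi>0 by (simp add: zero_prod_def)
  ultimately obtain \<epsilon> where \<epsilon>: "\<epsilon> > 0" "ball 0 \<epsilon> \<subseteq> (\<lambda>t. (t, 0)) -` V"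
    by (meson openE)
  define T where "T = {-\<epsilon><..<\<epsilon>}"
  have "T = ball 0 \<epsilon>" by (auto simp: T_def dist_real_def)
  then have TV: "(t, 0) \<in> V" if "t \<in> T" for t using \<epsilon>(2) that by auto
  have T: "open T" "0 \<in> T" using \<epsilon>(1) by (auto simp: T_def)
  define c where "c t = snd (g (t, 0))" for t
  define c' where "c' t v = snd (g' (t, 0) (v, 0))" for t v
  have gt: "g (t, 0) = (t, c t)" "h (P t (c t)) = 0" if "t \<in> T" for t
  proof -
    have "\<Phi> (g (t, 0)) = (t, 0)" using UV(4) TV[OF that] by (auto simp: homeomorphism_def)
    then show "g (t, 0) = (t, c t)" "h (P t (c t)) = 0"
      by (auto simp: \<Phi>_def c_def split: prod.splits)
  qed
  have c0: "c 0 = 0" using UV(1,4) \<Phi>0 by (metis c_def homeomorphism_apply1 snd_conv)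
  have derc: "(c has_derivative c' t) (at t)" if "t \<in> T" for t
  proof -
    have "((\<lambda>t. g (t, 0)) has_derivative (\<lambda>v. g' (t, 0) (v, 0))) (at t)"
      by (rule has_derivative_compose[of "\<lambda>t. (t, 0)" "\<lambda>v. (v, 0)", OF _ g[OF TV[OF that]]])
        (intro derivative_intros)
    then show ?thesis unfolding c_def c'_def by (rule has_derivative_snd)
  qed
  define Y where "Y t = P t (c t)" for t
  have derY: "(Y has_derivative (\<lambda>v. v *\<^sub>R \<eta> + A (c' t v))) (at t)" if "t \<in> T" for t
    unfolding Y_def P_def using derc[OF that]
    by (auto intro!: derivative_eq_intros bounded_linear.has_derivative[OF blA])
  have eq: "D (Y t) (v *\<^sub>R \<eta> + A (c' t v)) = 0" if "t \<in> T" for t v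
  proof -
    have "((\<lambda>t. h (Y t)) has_derivative (\<lambda>v. D (Y t) (v *\<^sub>R \<eta> + A (c' t v)))) (at t)"
      by (rule has_derivative_compose[OF derY[OF that] D])
    moreover have "((\<lambda>t. h (Y t)) has_derivative (\<lambda>v. 0)) (at t)"
      by (rule has_derivative_transform_within_open[of "\<lambda>_. 0" _ _ _ T])
        (use T that gt in \<open>auto simp: Y_def\<close>)
    ultimately show ?thesis by (rule has_derivative_unique[THEN fun_cong])
  qed
  have Y0: "Y 0 = x" by (simp add: Y_def c0 P0)
  have "c' 0 v = 0" for v
  proof -
    have "D x (A (c' 0 v)) = 0"
      using eq[OF T(2), of v] \<eta>
      by (simp add: Y0 linear_add[OF linD] linear_scale[OF linD] D_def[symmetric])
    then show ?thesis by (rule inj0)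
  qed
  then have Y'0: "(Y has_vector_derivative \<eta>) (at 0)"
    using derY[OF T(2)] linear_0[OF linA] by (simp add: has_vector_derivative_def)
  \<comment> \<open>The implicit equation \<open>eq\<close> gives back the derivative of \<open>c\<close> with the regularity of \<open>c\<close>,
     so that \<open>c\<close> gains one order of differentiability at each step.\<close>
  have CkY_if: "Ck_on k Y T" if "Ck_on k c T" for k
  proof -
    have "Ck_on k (\<lambda>t. x + t *\<^sub>R \<eta>) T"
      using T by (intro Ck_on_add Ck_on_const Ck_on_linear bounded_linear_scaleR_left)
    moreover have "Ck_on k (\<lambda>t. A (c t)) T"
      using Ck_on_bounded_linear[OF blA T(1) that] .
    ultimately show ?thesis using Ck_on_add[OF T(1)] unfolding Y_def P_def by blast
  qed
  have Ckc: "Ck_on k c T" for k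
  proof (induction k)
    case 0
    have "c differentiable (at t within T)" if "t \<in> T" for t
      using derc[OF that] differentiable_def differentiable_at_withinI by blast
    then show ?case by (auto simp: differentiable_on_def intro!: differentiable_imp_continuous_on)
  next
    case (Suc k)
    have DY: "Ck_on k (\<lambda>t. D (Y t) w) T" for w
      by (rule Ck_on_compose[OF open_UNIV T(1) subset_UNIV CkD CkY_if[OF Suc]])
    show ?case
    proof (rule Ck_on_SucI[OF T(1) derc])
      fix v
      define M where "M t = matrix (\<lambda>d. D (Y t) (A d))" for t
      have linDA: "linear (\<lambda>d. D (Y t) (A d))" for t
        using linear_compose[OF linA linD] by (simp add: o_def)
      show "Ck_on k (\<lambda>t. c' t v) T"
      proof (rule Ck_on_linear_system_solution[OF T(1)])
        show "Ck_on k (\<lambda>t. M t $ i $ j) T" for i j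
          unfolding M_def matrix_def using Ck_on_bounded_linear[OF bounded_linear_vec_nth T(1) DY] by simp
        show "Ck_on k (\<lambda>t. (- D (Y t) (v *\<^sub>R \<eta>)) $ i) T" for i
          using Ck_on_bounded_linear[OF bounded_linear_compose[OF bounded_linear_vec_nth
                bounded_linear_minus[OF bounded_linear_ident]] T(1) DY] by simp
        show "det (M t) \<noteq> 0" if "t \<in> T" for t
        proof -
          have "inj (blinfun_apply (\<Phi>' (t, c t)))"
            using bij[OF TV[OF that]] by (simp add: gt[OF that] bij_def)
          then have "inj (\<lambda>d. D (Y t) (A d))"
            unfolding \<Phi>' inj_def Y_def by (auto dest!: spec[of _ "0::real"])
          then show ?thesis unfolding M_def using det_nz_iff_inj[OF linDA] by blast
        qed
        show "M t *v c' t v = - D (Y t) (v *\<^sub>R \<eta>)" if "t \<in> T" for t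
          using eq[OF that, of v] unfolding M_def matrix_works[OF linear_matrix_vector_mul_eq[THEN iffD2, OF linDA]]
          by (simp add: linear_add[OF linD] eq_neg_iff_add_eq_0 add.commute)
      qed
    qed
  qed
  show thesis
  proof (rule that[of \<epsilon> Y])
    show "smooth_on Y {-\<epsilon><..<\<epsilon>}" using CkY_if[OF Ckc] by (simp add: smooth_on_def T_def)
    show "h (Y t) = 0" if "t \<in> {-\<epsilon><..<\<epsilon>}" for t
      using gt(2) that by (simp add: Y_def T_def)
    show "Y t - x - t *\<^sub>R \<eta> \<in> range (adjoint (frechet_derivative h (at x)))" for t
      by (simp add: Y_def P_def A_def D_def)
  qed (fact \<epsilon> Y0 Y'0)+
qed

section \<open>Tangent cones and derivatives along curves\<close>

text \<open>
  The gradient is a definite description, so its characterization requires both that the differential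
  is represented by a vector and that the vector is unique.
\<close>

lemma gradient_inner:
  fixes f :: "'a::euclidean_space \<Rightarrow> real"
  assumes "f differentiable (at x)"
  shows "gradient f x \<bullet> v = frechet_derivative f (at x) v"
proof -
  let ?D = "frechet_derivative f (at x)"
  have D: "(f has_derivative ?D) (at x)" using assms by (simp add: frechet_derivative_works)
  interpret D: linear ?D using has_derivative_linear[OF D] .
  have "?D = (\<lambda>v. v \<bullet> adjoint ?D 1)"
    using adjoint_works[OF D.linear_axioms, of _ 1] by (simp add: fun_eq_iff)
  then have "GDERIV f x :> adjoint ?D 1" using D by (simp add: gderiv_def)
  moreover have "g = adjoint ?D 1" if "GDERIV f x :> g" for g
  proof -
    have "(\<lambda>v. v \<bullet> g) = (\<lambda>v. v \<bullet> adjoint ?D 1)"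
      using that calculation has_derivative_unique unfolding gderiv_def by blast
    then show ?thesis by (metis inner_eq_zero_iff inner_diff_right right_minus_eq)
  qed
  ultimately have "gradient f x = adjoint ?D 1" unfolding gradient_def by (rule the_equality)
  then show ?thesis using adjoint_works[OF D.linear_axioms, of v 1] by (simp add: inner_commute)
qed

lemma tangent_cone_curve:
  assumes \<gamma>: "(\<gamma> has_vector_derivative v) (at 0)" and \<epsilon>: "\<epsilon> > 0"
    and S: "\<And>t. t \<in> {-\<epsilon><..<\<epsilon>} \<Longrightarrow> \<gamma> t \<in> S"
  shows "v \<in> tangent_cone S (\<gamma> 0)"
proof -
  \<comment> \<open>The offset \<open>2\<close> keeps \<open>t 0\<close> strictly inside the interval.\<close>
  define t where "t k = \<epsilon> / (real k + 2)" for k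
  have t: "t k > 0" "t k \<in> {-\<epsilon><..<\<epsilon>}" for k
  proof -
    show "t k > 0" using \<epsilon> by (simp add: t_def add_nonneg_pos)
    have "0 < \<epsilon> * (real k + 1)" using \<epsilon> by (simp add: add_nonneg_pos)
    then have "\<epsilon> < \<epsilon> * (real k + 2)" by (simp add: algebra_simps)
    then have "t k < \<epsilon>" by (simp add: t_def divide_less_eq add_nonneg_pos)
    with \<open>t k > 0\<close> show "t k \<in> {-\<epsilon><..<\<epsilon>}" using \<epsilon> by simp
  qed
  have t0: "t \<longlonglongrightarrow> 0"
    unfolding t_def using tendsto_mult_right_zero[OF LIMSEQ_ignore_initial_segment[OF lim_inverse_n, of 2], of \<epsilon>]
    by (simp add: divide_inverse add.commute)
  have "((\<lambda>s. (\<gamma> s - \<gamma> 0) /\<^sub>R s) \<longlongrightarrow> v) (at 0)"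
  proof (rule LIM_zero_cancel, rule tendsto_norm_zero_cancel, rule Lim_transform_eventually)
    show "((\<lambda>s. norm (\<gamma> (0 + s) - \<gamma> 0 - s *\<^sub>R v) / norm s) \<longlongrightarrow> 0) (at 0)"
      using \<gamma> unfolding has_vector_derivative_def has_derivative_at by blast
    have "norm (\<gamma> (0 + s) - \<gamma> 0 - s *\<^sub>R v) / norm s = norm ((\<gamma> s - \<gamma> 0) /\<^sub>R s - v)" if "s \<noteq> 0" for s
    proof -
      have "(\<gamma> s - \<gamma> 0) /\<^sub>R s - v = (\<gamma> s - \<gamma> 0 - s *\<^sub>R v) /\<^sub>R s"
        using that by (simp add: scaleR_right_diff_distrib)
      then show ?thesis by (simp add: divide_inverse mult.commute)
    qed
    then show "\<forall>\<^sub>F s in at 0. norm (\<gamma> (0 + s) - \<gamma> 0 - s *\<^sub>R v) / norm s =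
        norm ((\<gamma> s - \<gamma> 0) /\<^sub>R s - v)"
      by (auto simp: eventually_at_filter)
  qed
  moreover have "filterlim t (at 0) sequentially"
    using t0 t(1) by (auto simp: filterlim_at intro!: always_eventually) (metis less_irrefl)
  ultimately have "(\<lambda>k. (\<gamma> (t k) - \<gamma> 0) /\<^sub>R t k) \<longlonglongrightarrow> v"
    by (rule filterlim_compose)
  then show ?thesis unfolding tangent_cone_def using t S t0
    by (intro CollectI exI[of _ "\<lambda>k. \<gamma> (t k)"] exI[of _ t]) auto
qed

text \<open>
  Along the sequence that defines \<open>v\<close>, the function \<open>F\<close> does not change, so \<open>F'\<close> applied to the
  difference quotients equals the remainder of the linearization divided by \<open>t k\<close>, which vanishes in
  the limit.
\<close>

lemma derivative_tangent_cone_eq_0: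
  assumes F: "(F has_derivative F') (at x)" and "F x = 0" and F0: "\<And>y. y \<in> S \<Longrightarrow> F y = 0"
    and v: "v \<in> tangent_cone S x"
  shows "F' v = 0"
proof -
  obtain X t where X: "\<And>k. X k \<in> S" "\<And>k. t k > 0" "t \<longlonglongrightarrow> (0::real)"
    and lim: "(\<lambda>k. (X k - x) /\<^sub>R t k) \<longlonglongrightarrow> v"
    using v unfolding tangent_cone_def by blast
  interpret F': bounded_linear F' using has_derivative_bounded_linear[OF F] .
  have "(\<lambda>k. t k *\<^sub>R ((X k - x) /\<^sub>R t k)) \<longlonglongrightarrow> 0 *\<^sub>R v"
    by (intro tendsto_scaleR X(3) lim)
  moreover have "t k *\<^sub>R ((X k - x) /\<^sub>R t k) = X k - x" for k using X(2)[of k] by simp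
  ultimately have X0: "(\<lambda>k. X k - x) \<longlonglongrightarrow> 0" by simp
  have "norm (F' v) \<le> e * norm v" if "e > 0" for e
  proof -
    obtain d where d: "d > 0" "\<And>y. norm (y - x) < d \<Longrightarrow> norm (F y - F x - F' (y - x)) \<le> e * norm (y - x)"
      using F \<open>e > 0\<close> unfolding has_derivative_at_alt by blast
    have "\<forall>\<^sub>F k in sequentially. norm (X k - x) < d"
      using tendstoD[OF X0 d(1)] by simp
    then have "\<forall>\<^sub>F k in sequentially. norm (F' ((X k - x) /\<^sub>R t k)) \<le> e * norm ((X k - x) /\<^sub>R t k)"
    proof eventually_elim
      case (elim k)
      then have "norm (F' (X k - x)) \<le> e * norm (X k - x)"
        using d(2)[OF elim] F0[OF X(1)] \<open>F x = 0\<close> by simp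
      then have "inverse (t k) * norm (F' (X k - x)) \<le> inverse (t k) * (e * norm (X k - x))"
        using X(2)[of k] by (intro mult_left_mono) auto
      then show ?case using X(2)[of k] unfolding F'.scaleR norm_scaleR by (simp add: mult.left_commute)
    qed
    moreover have l1: "(\<lambda>k. norm (F' ((X k - x) /\<^sub>R t k))) \<longlonglongrightarrow> norm (F' v)"
      by (intro tendsto_norm F'.tendsto lim)
    moreover have l2: "(\<lambda>k. e * norm ((X k - x) /\<^sub>R t k)) \<longlonglongrightarrow> e * norm v"
      by (intro tendsto_intros lim)
    ultimately show ?thesis by (intro tendsto_le[OF trivial_limit_sequentially l2 l1])
  qed
  note * = this
  have "norm (F' v) \<le> 0"
  proof (rule field_le_epsilon)
    fix e :: real assume "e > 0"
    have pos: "norm v + 1 > 0" by (rule add_nonneg_pos) simp_all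
    have "norm (F' v) \<le> e / (norm v + 1) * norm v" by (rule *) (rule divide_pos_pos[OF \<open>e > 0\<close> pos])
    also have "\<dots> \<le> e / (norm v + 1) * (norm v + 1)"
      using pos \<open>e > 0\<close> by (intro mult_left_mono) simp_all
    also have "\<dots> = e" using pos by simp
    finally show "norm (F' v) \<le> 0 + e" by simp
  qed
  then show ?thesis by simp
qed

text \<open>
  For curves through a given point, the second term depends on the velocity \<open>Z1 0\<close> only and the
  first on the acceleration \<open>Z2\<close> only, so curves with the same velocity are compared through their
  accelerations.
\<close>

lemma second_derivative_along_curve:
  fixes f :: "'a::euclidean_space \<Rightarrow> real"
  assumes f: "Ck_on 2 f UNIV" and T: "open T" "0 \<in> T"
    and Z: "\<And>t. t \<in> T \<Longrightarrow> (Z has_vector_derivative Z1 t) (at t)"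
    and Z1: "(Z1 has_vector_derivative Z2) (at 0)"
  shows "deriv (deriv (\<lambda>t. f (Z t))) 0 = frechet_derivative f (at (Z 0)) Z2 +
    (\<Sum>b\<in>Basis. (Z1 0 \<bullet> b) * frechet_derivative (\<lambda>y. frechet_derivative f (at y) b) (at (Z 0)) (Z1 0))"
proof -
  define D where "D y = frechet_derivative f (at y)" for y
  define E where "E b y = frechet_derivative (\<lambda>y. D y b) (at y)" for b y
  have f2: "Ck_on (Suc (Suc 0)) f UNIV" using f by (simp add: numeral_2_eq_2)
  have D: "(f has_derivative D y) (at y)" for y
    unfolding D_def using f2 by (intro Ck_on_Suc_has_derivative) auto
  have E: "((\<lambda>y. D y b) has_derivative E b y) (at y)" for b y
    unfolding E_def using f2 by (intro Ck_on_Suc_has_derivative[of 0 _ UNIV]) (auto simp: Ck_on_Suc D_def)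
  have lin: "linear (D y)" for y using has_derivative_linear[OF D] .
  have linE: "linear (E b y)" for b y using has_derivative_linear[OF E] .
  have expand: "D y w = (\<Sum>b\<in>Basis. (w \<bullet> b) * D y b)" for y w
  proof -
    have "D y w = D y (\<Sum>b\<in>Basis. (w \<bullet> b) *\<^sub>R b)" by (simp add: euclidean_representation)
    also have "\<dots> = (\<Sum>b\<in>Basis. (w \<bullet> b) * D y b)"
      by (simp add: linear_sum[OF lin] linear_scale[OF lin])
    finally show ?thesis .
  qed
  have "((\<lambda>t. f (Z t)) has_real_derivative D (Z t) (Z1 t)) (at t)" if "t \<in> T" for t
    using has_derivative_compose[OF Z[OF that, unfolded has_vector_derivative_def] D]
    by (simp add: has_real_derivative_iff_has_vector_derivative has_vector_derivative_def linear_scale[OF lin])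
  then have eq: "deriv (\<lambda>t. f (Z t)) t = (\<Sum>b\<in>Basis. (Z1 t \<bullet> b) * D (Z t) b)" if "t \<in> T" for t
    using DERIV_imp_deriv that expand by metis
  have "((\<lambda>t. D (Z t) b) has_real_derivative E b (Z 0) (Z1 0)) (at 0)" for b
    using has_derivative_compose[OF Z[OF T(2), unfolded has_vector_derivative_def] E]
    by (simp add: has_real_derivative_iff_has_vector_derivative has_vector_derivative_def linear_scale[OF linE])
  moreover have "((\<lambda>t. Z1 t \<bullet> b) has_real_derivative Z2 \<bullet> b) (at 0)" for b
    unfolding has_real_derivative_iff_has_vector_derivative
    by (rule bounded_linear.has_vector_derivative[OF bounded_linear_inner_left Z1])
  ultimately have "((\<lambda>t. \<Sum>b\<in>Basis. (Z1 t \<bullet> b) * D (Z t) b) has_real_derivative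
      (\<Sum>b\<in>Basis. (Z2 \<bullet> b) * D (Z 0) b + E b (Z 0) (Z1 0) * (Z1 0 \<bullet> b))) (at 0)"
    by (intro DERIV_sum DERIV_mult)
  then have "(deriv (\<lambda>t. f (Z t)) has_real_derivative
      (\<Sum>b\<in>Basis. (Z2 \<bullet> b) * D (Z 0) b + E b (Z 0) (Z1 0) * (Z1 0 \<bullet> b))) (at 0)"
    by (rule has_field_derivative_transform_within_open[OF _ T]) (simp add: eq)
  then have "deriv (deriv (\<lambda>t. f (Z t))) 0 =
      (\<Sum>b\<in>Basis. (Z2 \<bullet> b) * D (Z 0) b + E b (Z 0) (Z1 0) * (Z1 0 \<bullet> b))"
    by (rule DERIV_imp_deriv)
  also have "\<dots> = D (Z 0) Z2 + (\<Sum>b\<in>Basis. (Z1 0 \<bullet> b) * E b (Z 0) (Z1 0))"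
    unfolding expand[of _ Z2] by (simp add: sum.distrib mult.commute)
  finally show ?thesis unfolding E_def D_def .
qed

section \<open>Matrices, kernels and orthogonal projectors\<close>

lemma bounded_bilinear_matrix_mult:
  "bounded_bilinear ((**) :: real^'n^'m \<Rightarrow> real^'p^'n \<Rightarrow> real^'p^'m)"
  unfolding bilinear_conv_bounded_bilinear[symmetric] bilinear_def
  by (auto intro!: linearI simp: matrix_add_ldistrib scalar_matrix_assoc matrix_scalar_ac
      matrix_matrix_mult_def vec_eq_iff sum.distrib sum_distrib_left algebra_simps)

lemma bounded_linear_transpose: "bounded_linear (transpose :: real^'n^'m \<Rightarrow> real^'m^'n)"
  unfolding linear_conv_bounded_linear[symmetric]
  by (auto intro!: linearI simp: transpose_def vec_eq_iff)

lemmas matrix_mult_bilinear_simps =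
  bounded_bilinear.add_left[OF bounded_bilinear_matrix_mult]
  bounded_bilinear.add_right[OF bounded_bilinear_matrix_mult]
  bounded_bilinear.diff_left[OF bounded_bilinear_matrix_mult]
  bounded_bilinear.diff_right[OF bounded_bilinear_matrix_mult]
  bounded_bilinear.minus_left[OF bounded_bilinear_matrix_mult]
  bounded_bilinear.minus_right[OF bounded_bilinear_matrix_mult]
  bounded_bilinear.scaleR_left[OF bounded_bilinear_matrix_mult]
  bounded_bilinear.scaleR_right[OF bounded_bilinear_matrix_mult]
  bounded_bilinear.zero_left[OF bounded_bilinear_matrix_mult]
  bounded_bilinear.zero_right[OF bounded_bilinear_matrix_mult]

lemma inner_matrix_eq_trace:
  fixes A B :: "real^'n^'m"
  shows "A \<bullet> B = trace (transpose A ** B)"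
  unfolding inner_vec_def trace_def transpose_def matrix_matrix_mult_def
  by simp (rule sum.swap)

definition outer :: "real^'m \<Rightarrow> real^'n \<Rightarrow> real^'n^'m"
  where "outer u v = (\<chi> i j. u $ i * v $ j)"

lemma outer_mult_vector: "outer u v *v z = (v \<bullet> z) *\<^sub>R u"
  by (simp add: outer_def matrix_vector_mult_def inner_vec_def vec_eq_iff sum_distrib_left
      mult_ac)

lemma mult_outer: "A ** outer u v = outer (A *v u) v"
  by (simp add: outer_def matrix_matrix_mult_def matrix_vector_mult_def vec_eq_iff
      sum_distrib_left mult_ac)

lemma outer_mult_outer: "outer u v ** outer w z = (v \<bullet> w) *\<^sub>R outer u z"
  by (simp add: mult_outer outer_mult_vector) (simp add: outer_def vec_eq_iff)

lemma transpose_outer: "transpose (outer u v) = outer v u"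
  by (simp add: outer_def transpose_def vec_eq_iff mult_ac)

lemma trace_outer: "trace (outer u v) = u \<bullet> v"
  by (simp add: outer_def trace_def inner_vec_def)

lemma inner_outer: "A \<bullet> outer u v = u \<bullet> (A *v v)"
  by (simp add: outer_def inner_vec_def matrix_vector_mult_def sum_distrib_left mult_ac)

lemma outer_0 [simp]: "outer 0 v = 0"
  by (simp add: outer_def vec_eq_iff)

lemma outer_minus: "outer (- u) v = - outer u v"
  by (simp add: outer_def vec_eq_iff)

lemma dim_orthogonal:
  fixes S :: "(real^'n) set"
  shows "dim {z. \<forall>x\<in>S. x \<bullet> z = 0} + dim S = CARD('n)"
proof -
  have "{z. \<forall>x\<in>S. x \<bullet> z = 0} = {y \<in> UNIV. \<forall>x\<in>span S. orthogonal x y}"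
  proof (intro Collect_cong iffI conjI ballI)
    show "orthogonal x y" if "\<forall>x\<in>S. x \<bullet> y = 0" "x \<in> span S" for x y
      using orthogonal_to_span[of x S y] that by (simp add: orthogonal_def inner_commute)
  qed (auto simp: orthogonal_def span_base)
  then show ?thesis
    using dim_subspace_orthogonal_to_vectors[of "span S" UNIV] by simp
qed

lemma kernel_eq_orthogonal_rows:
  fixes A :: "real^'n^'m"
  shows "A *v z = 0 \<longleftrightarrow> (\<forall>x\<in>rows A. x \<bullet> z = 0)"
proof -
  have "rows A = range (\<lambda>i. A $ i)" by (auto simp: rows_def row_def vec_lambda_eta)
  then show ?thesis by (simp add: matrix_mult_dot vec_eq_iff)
qed

lemma dim_kernel:
  fixes A :: "real^'n^'m"
  shows "dim {z. A *v z = 0} + rank A = CARD('n)"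
  unfolding kernel_eq_orthogonal_rows row_rank_def by (rule dim_orthogonal)

lemma rank_le_dim_if_kernel:
  fixes A :: "real^'n^'m"
  assumes "\<And>z. (\<And>x. x \<in> S \<Longrightarrow> x \<bullet> z = 0) \<Longrightarrow> A *v z = 0"
  shows "rank A \<le> dim S"
proof -
  have "dim {z. \<forall>x\<in>S. x \<bullet> z = 0} \<le> dim {z. A *v z = 0}"
    by (rule dim_subset) (use assms in auto)
  then show ?thesis using dim_orthogonal[of S] dim_kernel[of A] by simp
qed

lemma subspace_matrix_kernel: "subspace {z. (A :: real^'n^'m) *v z = 0}"
  by (auto simp: subspace_def matrix_vector_right_distrib matrix_vector_mult_scaleR)

text \<open>
  Otherwise \<open>B\<close> would be injective on the kernel of \<open>A\<close>, whose dimension exceeds \<open>rank B\<close>.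
\<close>

lemma common_kernel_nontrivial:
  fixes A :: "real^'n^'m" and B :: "real^'n^'p"
  assumes "rank A + rank B < CARD('n)"
  obtains w where "norm w = 1" "A *v w = 0" "B *v w = 0"
proof -
  have "rank A < CARD('n)" using assms by simp
  have "\<exists>w\<noteq>0. A *v w = 0 \<and> B *v w = 0"
  proof (rule ccontr)
    assume "\<not> ?thesis"
    then have ker: "A *v w = 0 \<Longrightarrow> B *v w = 0 \<Longrightarrow> w = 0" for w by blast
    have inj: "inj_on ((*v) B) {z. A *v z = 0}"
    proof (rule inj_onI)
      fix x y assume "x \<in> {z. A *v z = 0}" "y \<in> {z. A *v z = 0}" "B *v x = B *v y"
      then show "x = y" using ker[of "x - y"] by (simp add: matrix_vector_mult_diff_distrib)
    qed
    have "dim {z. A *v z = 0} = dim ((*v) B ` {z. A *v z = 0})"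
      by (rule dim_image_eq[OF matrix_vector_mul_linear, symmetric])
        (subst span_eq_iff[THEN iffD2, OF subspace_matrix_kernel], rule inj)
    also have "\<dots> \<le> rank B"
      unfolding rank_dim_range by (rule dim_subset) auto
    finally show False using dim_kernel[of A] assms by simp
  qed
  then obtain w where "w \<noteq> 0" "A *v w = 0" "B *v w = 0" by blast
  then show thesis using that[of "w /\<^sub>R norm w"] by (simp add: matrix_vector_mult_scaleR)
qed

lemma GrD:
  assumes "G \<in> Gr k"
  shows "transpose G = G" "G ** G = G" "rank G = k" "G *v (G *v z) = G *v z"
  using assms by (auto simp: Gr_def matrix_vector_mul_assoc)

text \<open>
  The projector is \<open>\<Sum> b b\<^sup>T\<close> over an orthonormal basis; this form also yields its trace, which is why
  the trace is stated here and transferred to arbitrary projectors afterwards.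
\<close>

lemma exists_projector:
  fixes S :: "(real^'n) set"
  assumes "subspace S"
  obtains G where "G \<in> Gr (dim S)" "trace G = dim S" "\<And>z. G *v z \<in> S" "\<And>z. z \<in> S \<Longrightarrow> G *v z = z"
    "\<And>z. (\<And>x. x \<in> S \<Longrightarrow> x \<bullet> z = 0) \<Longrightarrow> G *v z = 0"
proof -
  obtain B where B: "B \<subseteq> S" "pairwise orthogonal B" "\<And>x. x \<in> B \<Longrightarrow> norm x = 1"
    "independent B" "card B = dim S" "span B = S"
    using orthonormal_basis_subspace[OF assms] by metis
  define G where "G = (\<Sum>b\<in>B. outer b b)"
  have fin: "finite B" using B(4) by (rule independent_imp_finite)
  have Gz: "G *v z = (\<Sum>b\<in>B. (b \<bullet> z) *\<^sub>R b)" for z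
  proof -
    have "(\<Sum>b\<in>C. outer b b) *v z = (\<Sum>b\<in>C. (b \<bullet> z) *\<^sub>R b)" for C :: "(real^'n) set"
      by (induction C rule: infinite_finite_induct)
        (auto simp: matrix_vector_mult_add_rdistrib outer_mult_vector)
    then show ?thesis by (simp add: G_def)
  qed
  have Gb: "G *v b = b" if "b \<in> B" for b
  proof -
    have "(\<Sum>c\<in>B. (c \<bullet> b) *\<^sub>R c) = (\<Sum>c\<in>B. if c = b then b else 0)"
      using B(2,3) that by (intro sum.cong) (auto simp: pairwise_def orthogonal_def norm_eq_1)
    then show ?thesis using Gz fin that by simp
  qed
  have Gid: "G *v z = z" if "z \<in> S" for z
  proof -
    have "z \<in> span B" using that B(6) by simp
    then show ?thesis
      by (induction rule: span_induct_alt)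
        (auto simp: Gb matrix_vector_right_distrib matrix_vector_mult_scaleR)
  qed
  have GS: "G *v z \<in> S" for z
    unfolding Gz using B(1) assms by (auto intro!: subspace_sum subspace_scale)
  have range: "range ((*v) G) = S" using GS Gid by (auto simp: image_iff) metis
  show thesis
  proof (rule that)
    have "transpose (\<Sum>b\<in>C. outer b b) = (\<Sum>b\<in>C. outer b b)" for C :: "(real^'n) set"
      by (simp add: linear_sum[OF bounded_linear.linear[OF bounded_linear_transpose]] transpose_outer)
    moreover have "G ** G = G"
      by (simp add: matrix_eq matrix_vector_mul_assoc[symmetric] Gid GS)
    moreover have "rank G = dim S" by (simp add: rank_dim_range range)
    ultimately show "G \<in> Gr (dim S)" by (simp add: Gr_def G_def)
    have "trace (\<Sum>b\<in>C. outer b b) = (\<Sum>b\<in>C. b \<bullet> b)" for C :: "(real^'n) set"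
      by (induction C rule: infinite_finite_induct) (auto simp: trace_add trace_outer, auto simp: trace_def)
    then show "trace G = dim S" using B(3) by (simp add: G_def norm_eq_1 flip: B(5))
    show "G *v z = 0" if "\<And>x. x \<in> S \<Longrightarrow> x \<bullet> z = 0" for z
      unfolding Gz using that B(1) by (auto intro!: sum.neutral)
  qed (use GS Gid in auto)
qed

text \<open>
  An orthogonal projector is determined by its range, so it is the one built from an orthonormal
  basis of the range, whose trace is known.
\<close>

lemma trace_projector:
  fixes G :: "real^'n^'n"
  assumes "G \<in> Gr k"
  shows "trace G = k"
proof -
  note G = GrD[OF assms]
  have S: "subspace (range ((*v) G))" by (simp add: linear_subspace_image)
  obtain P where P: "trace P = dim (range ((*v) G))" "\<And>z. z \<in> range ((*v) G) \<Longrightarrow> P *v z = z"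
    "\<And>z. (\<And>x. x \<in> range ((*v) G) \<Longrightarrow> x \<bullet> z = 0) \<Longrightarrow> P *v z = 0"
    using exists_projector[OF S] by metis
  have sym: "(G *v x) \<bullet> y = x \<bullet> (G *v y)" for x y
    using G(1) by (metis dot_lmul_matrix transpose_matrix_vector)
  have "P *v z = G *v z" for z
  proof -
    have "P *v (z - G *v z) = 0"
      by (rule P(3)) (auto simp: sym matrix_vector_mult_diff_distrib G(4))
    then show ?thesis using P(2)[of "G *v z"] by (simp add: matrix_vector_mult_diff_distrib)
  qed
  then have "P = G" by (simp add: matrix_eq)
  then show ?thesis using P(1) G(3) by (simp add: rank_dim_range)
qed

lemma exists_projector_annihilated:
  fixes X :: "real^'n^'m"
  assumes "rank X \<le> r"
  shows "\<exists>G \<in> Gr (CARD('n) - r). X ** G = 0"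
proof -
  have "CARD('n) - r \<le> dim {z. X *v z = 0}" using dim_kernel[of X] assms by simp
  then obtain T where T: "subspace T" "T \<subseteq> {z. X *v z = 0}" "dim T = CARD('n) - r"
    using choose_subspace_of_subspace
      span_eq_iff[THEN iffD2, OF subspace_matrix_kernel[of X]] by metis
  obtain G where "G \<in> Gr (dim T)" "\<And>z. G *v z \<in> T"
    using exists_projector[OF T(1)] by metis
  then show ?thesis
    using T by (intro bexI[of _ G]) (auto simp: matrix_eq matrix_vector_mul_assoc[symmetric])
qed

text \<open>
  All inner products that occur reduce to the trace of \<open>G H\<close> and to the traces of \<open>G\<close> and \<open>H\<close>, and
  the latter two agree because the ranks do. Without equal ranks, \<open>(I - G) H\<close> can vanish for distinct
  projectors.
\<close>

lemma norm_diff_projectors: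
  fixes G H :: "real^'n^'n"
  assumes G: "G \<in> Gr k" and H: "H \<in> Gr k"
  shows "norm (H - G) ^ 2 = 2 * norm ((mat 1 - G) ** H) ^ 2"
proof -
  note g = GrD[OF G] and h = GrD[OF H]
  have GG: "G \<bullet> G = k" "H \<bullet> H = k"
    using g h trace_projector[OF G] trace_projector[OF H] by (simp_all add: inner_matrix_eq_trace)
  have HG: "H \<bullet> G = trace (G ** H)" "H \<bullet> (G ** H) = trace (G ** H)" "(G ** H) \<bullet> (G ** H) = trace (G ** H)"
    unfolding inner_matrix_eq_trace matrix_transpose_mul g(1) h(1)
    by (metis g(2) h(2) matrix_mul_assoc trace_mul_sym)+
  show ?thesis
    unfolding power2_norm_eq_inner
    by (simp add: matrix_mult_bilinear_simps inner_diff inner_commute GG HG) (simp add: HG inner_commute[of _ H] GG)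
qed

text \<open>
  The range of \<open>G\<close> lies in the kernel of \<open>X\<close>, and both have the same dimension.
\<close>

lemma kernel_eq_range_projector:
  fixes X :: "real^'n^'m"
  assumes G: "G \<in> Gr (CARD('n) - rank X)" and XG: "X ** G = 0" and z: "X *v z = 0"
  shows "G *v z = z"
proof -
  have "range ((*v) G) = {z. X *v z = 0}"
  proof (rule subspace_dim_equal)
    show "range ((*v) G) \<subseteq> {z. X *v z = 0}" using XG by (auto simp: matrix_vector_mul_assoc)
    show "dim {z. X *v z = 0} \<le> dim (range ((*v) G))"
      using dim_kernel[of X] GrD(3)[OF G] by (simp add: rank_dim_range)
  qed (simp_all add: linear_subspace_image subspace_matrix_kernel)
  then obtain y where "z = G *v y" using z by (metis (mono_tags) imageE mem_Collect_eq)
  then show ?thesis using GrD(4)[OF G] by simp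
qed

section \<open>Orthogonally invariant constraints\<close>

text \<open>
  The reflection \<open>I - 2 G\<close> is orthogonal, fixes \<open>X\<close> and maps \<open>E G\<close> to \<open>- E G\<close>. Invariance of \<open>h\<close> thus
  gives the derivative in the direction \<open>E G\<close> the same value as in the opposite direction.
\<close>

lemma derivative_orthogonally_invariant_projector:
  fixes h :: "real^'n^'m \<Rightarrow> real^'q" and G :: "real^'n^'n"
  assumes inv: "orthogonally_invariant h" and h: "h differentiable (at X)"
    and G: "transpose G = G" "G ** G = G" and XG: "X ** G = 0"
  shows "frechet_derivative h (at X) (E ** G) = 0"
proof -
  let ?D = "frechet_derivative h (at X)"
  have D: "(h has_derivative ?D) (at X)" using h by (simp add: frechet_derivative_works)
  define Q where "Q = mat 1 - 2 *\<^sub>R G"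
  have bl: "bounded_linear (\<lambda>Y :: real^'n^'m. Y ** Q)"
    by (rule bounded_bilinear.bounded_linear_left[OF bounded_bilinear_matrix_mult])
  have "transpose Q = Q"
    unfolding Q_def
    by (simp add: linear_diff[OF bounded_linear.linear[OF bounded_linear_transpose]] transpose_scalar G)
  moreover have "Q ** Q = mat 1"
    by (simp add: Q_def matrix_mult_bilinear_simps G) (simp add: scaleR_2)
  ultimately have "orthogonal_matrix Q" by (simp add: orthogonal_matrix_def)
  then have hQ: "h (Y ** Q) = h Y" for Y using inv by (simp add: orthogonally_invariant_def)
  have "X ** Q = X" by (simp add: Q_def matrix_mult_bilinear_simps XG)
  then have "((\<lambda>Y. h (Y ** Q)) has_derivative (\<lambda>E. ?D (E ** Q))) (at X)"
    using has_derivative_compose[OF bounded_linear_imp_has_derivative[OF bl], of h ?D] D by simp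
  then have "?D (E ** G ** Q) = ?D (E ** G)"
    unfolding hQ using has_derivative_unique[OF D] by metis
  moreover have "E ** G ** Q = - (E ** G)"
    by (simp add: Q_def matrix_mult_bilinear_simps matrix_mul_assoc[symmetric] G)
      (simp add: scaleR_2)
  ultimately have "- ?D (E ** G) = ?D (E ** G)"
    by (simp add: linear_neg[OF has_derivative_linear[OF D]])
  then have "2 *\<^sub>R ?D (E ** G) = 0" unfolding scaleR_2 by (metis neg_eq_iff_add_eq_0)
  then show ?thesis by simp
qed

text \<open>
  The projector onto the line through \<open>z\<close> leaves \<open>outer u z\<close> unchanged.
\<close>

lemma derivative_orthogonally_invariant_outer:
  fixes h :: "real^'n^'m \<Rightarrow> real^'q"
  assumes inv: "orthogonally_invariant h" and h: "h differentiable (at X)" and Xz: "X *v z = 0"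
  shows "frechet_derivative h (at X) (outer u z) = 0"
proof (cases "z = 0")
  case True
  then have "outer u z = 0" by (simp add: outer_def vec_eq_iff)
  then show ?thesis using h linear_0[OF has_derivative_linear] frechet_derivative_works by metis
next
  case False
  define G where "G = (1 / (z \<bullet> z)) *\<^sub>R outer z z"
  have "transpose G = G" by (simp add: G_def transpose_scalar transpose_outer)
  moreover have "G ** G = G" "outer u z ** G = outer u z"
    using False by (simp_all add: G_def matrix_mult_bilinear_simps outer_mult_outer)
  moreover have "X ** G = 0" by (simp add: G_def matrix_mult_bilinear_simps mult_outer Xz)
  ultimately show ?thesis using derivative_orthogonally_invariant_projector[OF inv h] by metis
qed

text \<open>
  The correction term of \<open>smooth_curve_in_level_set\<close> lies in the range of the adjoint of \<open>D h\<close>, which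
  vanishes on the kernel of \<open>X\<close> since \<open>D h\<close> annihilates all \<open>u z\<^sup>T\<close> with \<open>X z = 0\<close>. Hence on the
  kernel of \<open>X\<close> the curve \<open>Y\<close> acts exactly as \<open>t \<eta>\<close> does.
\<close>

lemma feasible_curve:
  fixes h :: "real^'n^'m \<Rightarrow> real^'q"
  assumes h: "smooth_on h UNIV" and inv: "orthogonally_invariant h" and hX: "h X = 0"
    and surj: "dim (range (frechet_derivative h (at X))) = CARD('q)"
    and \<eta>: "frechet_derivative h (at X) \<eta> = 0"
  obtains \<epsilon> Y where "\<epsilon> > 0" "smooth_on Y {-\<epsilon><..<\<epsilon>}" "Y 0 = X" "(Y has_vector_derivative \<eta>) (at 0)"
    "\<And>t. t \<in> {-\<epsilon><..<\<epsilon>} \<Longrightarrow> h (Y t) = 0"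
    "\<And>t z. t \<in> {-\<epsilon><..<\<epsilon>} \<Longrightarrow> X *v z = 0 \<Longrightarrow> Y t *v z = t *\<^sub>R (\<eta> *v z)"
proof -
  let ?D = "frechet_derivative h (at X)"
  have hd: "h differentiable (at X)" by (rule smooth_on_differentiable[OF h UNIV_I])
  then have lin: "linear ?D" using has_derivative_linear frechet_derivative_works by blast
  have "subspace (range ?D)" by (rule linear_subspace_image[OF lin]) simp
  then have "range ?D = UNIV"
    using dim_eq_full[of "range ?D"] surj by (simp add: span_eq_iff[THEN iffD2])
  then obtain \<epsilon> Y where Y: "\<epsilon> > 0" "smooth_on Y {-\<epsilon><..<\<epsilon>}" "Y 0 = X" "(Y has_vector_derivative \<eta>) (at 0)"
    "\<And>t. t \<in> {-\<epsilon><..<\<epsilon>} \<Longrightarrow> h (Y t) = 0"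
    "\<And>t. t \<in> {-\<epsilon><..<\<epsilon>} \<Longrightarrow> Y t - X - t *\<^sub>R \<eta> \<in> range (adjoint ?D)"
    using smooth_curve_in_level_set[OF h hX _ \<eta>] by metis
  have adj0: "adjoint ?D c *v z = 0" if "X *v z = 0" for c z
  proof -
    have "u \<bullet> (adjoint ?D c *v z) = 0" for u
      using adjoint_works[OF lin, of "outer u z" c]
        derivative_orthogonally_invariant_outer[OF inv hd that, of u]
      by (simp add: inner_commute[of "outer u z"] inner_outer)
    then show ?thesis by (metis inner_eq_zero_iff)
  qed
  show thesis
  proof (rule that[OF Y(1-5)])
    fix t z assume t: "t \<in> {-\<epsilon><..<\<epsilon>}" and z: "X *v z = 0"
    obtain c where "Y t - X - t *\<^sub>R \<eta> = adjoint ?D c" using Y(6)[OF t] by blast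
    then have "(Y t - X - t *\<^sub>R \<eta>) *v z = 0" using adj0[OF z] by simp
    then show "Y t *v z = t *\<^sub>R (\<eta> *v z)"
      using z by (simp add: matrix_vector_mult_diff_rdistrib scaleR_matrix_vector_assoc)
  qed
qed

section \<open>First-order stationarity at points of full rank\<close>

lemma derivative_comp_\<phi>:
  assumes "f differentiable (at (fst p))"
  shows "frechet_derivative (f \<circ> \<phi>) (at p) v = frechet_derivative f (at (fst p)) (fst v)"
proof -
  have "(f has_derivative frechet_derivative f (at (fst p))) (at (fst p))"
    using assms by (simp add: frechet_derivative_works)
  from has_derivative_compose[OF has_derivative_fst[OF has_derivative_ident] this]
  have "((\<lambda>p. f (fst p)) has_derivative (\<lambda>v. frechet_derivative f (at (fst p)) (fst v))) (at p)" .
  moreover have "f \<circ> \<phi> = (\<lambda>p. f (fst p))" by (simp add: fun_eq_iff \<phi>_def split: prod.split)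
  ultimately show ?thesis by (metis frechet_derivative_at)
qed

lemma rank_le_if_M_h:
  fixes X :: "real^'n^'m"
  assumes "(X, G) \<in> M_h r h" and "r \<le> CARD('n)"
  shows "rank X \<le> r"
proof -
  have G: "G \<in> Gr (CARD('n) - r)" "X ** G = 0" using assms(1) by (auto simp: M_h_def)
  have "rank G \<le> dim {z. X *v z = 0}"
    unfolding rank_dim_range using G(2) by (intro dim_subset) (auto simp: matrix_vector_mul_assoc)
  then show ?thesis using dim_kernel[of X] GrD(3)[OF G(1)] \<open>r \<le> CARD('n)\<close> by simp
qed

lemma stationary_originalI:
  fixes f :: "real^'n^'m \<Rightarrow> real"
  assumes "(X, G) \<in> M_h r h" and "r \<le> CARD('n)" and f: "f differentiable (at X)"
    and nonneg: "\<And>\<eta>. \<eta> \<in> tangent_cone (bounded_rank r \<inter> zero_set h) X \<Longrightarrow>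
      frechet_derivative f (at X) \<eta> \<ge> 0"
  shows "stationary_original r h f X"
proof -
  have "h X = 0" using assms(1) by (simp add: M_h_def)
  then show ?thesis
    using rank_le_if_M_h[OF assms(1,2)] nonneg
    by (simp add: stationary_original_def bounded_rank_def zero_set_def gradient_inner[OF f])
qed

text \<open>
  For each point of the sequence that defines \<open>\<eta>\<close>, choose any projector \<open>G\<^sub>k\<close> of the right rank that it
  annihilates. The difference quotients of \<open>G\<^sub>k\<close> are bounded by a multiple of those of \<open>X\<^sub>k\<close>, so a subsequence of
  them converges, and its limit is the second component \<open>\<zeta>\<close>.
\<close>

lemma tangent_cone_lift:
  fixes X :: "real^'n^'m"
  assumes XG: "(X, G) \<in> M_h (rank X) h"
    and \<eta>: "\<eta> \<in> tangent_cone (bounded_rank (rank X) \<inter> zero_set h) X"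
  shows "\<exists>\<zeta>. (\<eta>, \<zeta>) \<in> tangent_cone (M_h (rank X) h) (X, G)"
proof -
  have G: "G \<in> Gr (CARD('n) - rank X)" "X ** G = 0" using XG by (auto simp: M_h_def)
  note g = GrD[OF G(1)]
  obtain Xk t where Xk: "\<And>k. rank (Xk k) \<le> rank X" "\<And>k. h (Xk k) = 0"
    and t: "\<And>k. t k > (0::real)" "t \<longlonglongrightarrow> 0"
    and lim: "(\<lambda>k. (Xk k - X) /\<^sub>R t k) \<longlonglongrightarrow> \<eta>"
    using \<eta> unfolding tangent_cone_def bounded_rank_def zero_set_def by auto
  have "\<forall>k. \<exists>H. H \<in> Gr (CARD('n) - rank X) \<and> Xk k ** H = 0"
    using exists_projector_annihilated[OF Xk(1)] by blast
  then obtain Gk where Gk: "\<And>k. Gk k \<in> Gr (CARD('n) - rank X)" "\<And>k. Xk k ** Gk k = 0" by metis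

  \<comment> \<open>The range of \<open>G\<close> is all of the kernel of \<open>X\<close>, so multiplication by \<open>X\<close> is injective, hence
     bounded below, on the matrices with columns orthogonal to that range.\<close>
  have "\<exists>e>0. \<forall>Z\<in>{Z :: real^'n^'n. G ** Z = 0}. e * norm Z \<le> norm (X ** Z)"
  proof (rule injective_imp_isometric)
    show "subspace {Z :: real^'n^'n. G ** Z = 0}"
      by (auto simp: subspace_def matrix_mult_bilinear_simps)
    then show "closed {Z :: real^'n^'n. G ** Z = 0}" by (rule closed_subspace)
    show "bounded_linear (\<lambda>Z :: real^'n^'n. X ** Z)"
      by (rule bounded_bilinear.bounded_linear_right[OF bounded_bilinear_matrix_mult])
    show "\<forall>Z\<in>{Z :: real^'n^'n. G ** Z = 0}. X ** Z = 0 \<longrightarrow> Z = 0"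
    proof (intro ballI impI)
      fix Z :: "real^'n^'n" assume "Z \<in> {Z. G ** Z = 0}" and XZ: "X ** Z = 0"
      moreover have "G *v (Z *v z) = Z *v z" for z
        using kernel_eq_range_projector[OF G, of "Z *v z"] by (simp add: matrix_vector_mul_assoc XZ)
      ultimately show "Z = 0" by (simp add: matrix_eq matrix_vector_mul_assoc)
    qed
  qed
  then obtain e where e: "e > 0" "\<And>Z :: real^'n^'n. G ** Z = 0 \<Longrightarrow> e * norm Z \<le> norm (X ** Z)" by blast
  obtain K where K: "K > 0" "\<And>A B. norm ((A :: real^'n^'m) ** (B :: real^'n^'n)) \<le> norm A * norm B * K"
    using bounded_bilinear.pos_bounded[OF bounded_bilinear_matrix_mult] by metis
  define N where "N = sqrt (CARD('n) - rank X)"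
  have normG: "norm H = N" if "H \<in> Gr (CARD('n) - rank X)" for H :: "real^'n^'n"
    unfolding N_def norm_eq_sqrt_inner inner_matrix_eq_trace using GrD[OF that] trace_projector[OF that] by simp
  define C where "C = sqrt 2 * N * K / e"
  have le: "norm (Gk k - G) \<le> C * norm (Xk k - X)" for k
  proof -
    let ?Z = "(mat 1 - G) ** Gk k"
    have "X ** ?Z = - ((Xk k - X) ** Gk k)"
      by (simp add: matrix_mult_bilinear_simps matrix_mul_assoc G(2) Gk(2))
    moreover have "G ** ?Z = 0" by (simp add: matrix_mult_bilinear_simps matrix_mul_assoc g(2))
    ultimately have "e * norm ?Z \<le> norm (Xk k - X) * N * K"
      using e(2)[of ?Z] K(2)[of "Xk k - X" "Gk k"] by (simp add: normG[OF Gk(1)])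
    then have Z: "norm ?Z \<le> norm (Xk k - X) * N * K / e"
      using e(1) by (simp add: field_simps)
    have "norm (Gk k - G) = sqrt 2 * norm ?Z"
      by (rule power2_eq_imp_eq) (simp_all add: norm_diff_projectors[OF G(1) Gk(1)] power_mult_distrib)
    also have "\<dots> \<le> sqrt 2 * (norm (Xk k - X) * N * K / e)"
      by (rule mult_left_mono[OF Z]) simp
    finally show ?thesis by (simp add: C_def mult_ac)
  qed
  have "C \<ge> 0" using e(1) K(1) by (simp add: C_def N_def)
  obtain M where M: "\<And>k. norm ((Xk k - X) /\<^sub>R t k) \<le> M"
    using convergent_imp_Bseq[OF convergentI[OF lim]] unfolding Bseq_def by blast
  have "norm ((Gk k - G) /\<^sub>R t k) \<le> C * M" for k
  proof -
    have "inverse (t k) * norm (Gk k - G) \<le> inverse (t k) * (C * norm (Xk k - X))"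
      by (rule mult_left_mono[OF le]) (use t(1)[of k] in simp)
    also have "\<dots> = C * norm ((Xk k - X) /\<^sub>R t k)" using t(1)[of k] by simp
    also have "\<dots> \<le> C * M" by (rule mult_left_mono[OF M \<open>C \<ge> 0\<close>])
    finally show ?thesis using t(1)[of k] by simp
  qed
  then have "bounded (range (\<lambda>k. (Gk k - G) /\<^sub>R t k))" by (auto simp: bounded_iff)
  then obtain \<zeta> s where s: "strict_mono s" "((\<lambda>k. (Gk k - G) /\<^sub>R t k) \<circ> s) \<longlonglongrightarrow> \<zeta>"
    using bounded_imp_convergent_subsequence by blast
  have "(\<lambda>k. ((Xk (s k), Gk (s k)) - (X, G)) /\<^sub>R t (s k)) \<longlonglongrightarrow> (\<eta>, \<zeta>)"
    using tendsto_Pair[OF LIMSEQ_subseq_LIMSEQ[OF lim s(1)] s(2)] by (simp add: o_def)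
  moreover have "(\<lambda>k. t (s k)) \<longlonglongrightarrow> 0" using LIMSEQ_subseq_LIMSEQ[OF t(2) s(1)] by (simp add: o_def)
  ultimately have "(\<eta>, \<zeta>) \<in> tangent_cone (M_h (rank X) h) (X, G)"
    unfolding tangent_cone_def using t(1) Xk(2) Gk
    by (intro CollectI exI[of _ "\<lambda>k. (Xk (s k), Gk (s k))"] exI[of _ "\<lambda>k. t (s k)"])
      (auto simp: M_h_def)
  then show ?thesis by blast
qed

lemma one_implies_one_full_rank:
  fixes X :: "real^'n^'m"
  assumes XG: "(X, G) \<in> M_h (rank X) h"
  shows "one_implies_one (rank X) h (X, G)"
  unfolding one_implies_one_def
proof (intro allI impI)
  fix f :: "real^'n^'m \<Rightarrow> real" assume f: "Ck_on 2 f UNIV" and st: "stationary1_reformulated (rank X) h f (X, G)"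
  have fd: "f differentiable (at X)" using f by (simp add: numeral_2_eq_2 Ck_on_Suc)
  have "stationary_original (rank X) h f X"
  proof (rule stationary_originalI[OF XG _ fd])
    show "rank X \<le> CARD('n)" using rank_bound[of X] by simp
    fix \<eta> assume "\<eta> \<in> tangent_cone (bounded_rank (rank X) \<inter> zero_set h) X"
    then obtain \<zeta> where "(\<eta>, \<zeta>) \<in> tangent_cone (M_h (rank X) h) (X, G)" using tangent_cone_lift[OF XG] by blast
    then have "frechet_derivative (f \<circ> \<phi>) (at (X, G)) (\<eta>, \<zeta>) = 0"
      using st unfolding stationary1_reformulated_def by blast
    then show "frechet_derivative f (at X) \<eta> \<ge> 0" using derivative_comp_\<phi>[of f "(X, G)"] fd by simp
  qed
  then show "stationary_original (rank X) h f (\<phi> (X, G))" by (simp add: \<phi>_def)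
qed

section \<open>First-order stationarity at rank-deficient points\<close>

text \<open>
  This differentiates the equation \<open>X G = 0\<close>.
\<close>

lemma tangent_cone_M_h_product_rule:
  assumes XG: "(X, G) \<in> M_h r h" and v: "(\<eta>, \<zeta>) \<in> tangent_cone (M_h r h) (X, G)"
  shows "\<eta> ** G + X ** \<zeta> = 0"
proof -
  have "X ** G = 0" using XG by (simp add: M_h_def)
  have "((\<lambda>p. fst p ** snd p) has_derivative (\<lambda>v. X ** snd v + fst v ** G)) (at (X, G))"
    using bounded_bilinear.FDERIV[OF bounded_bilinear_matrix_mult
        has_derivative_fst[OF has_derivative_ident] has_derivative_snd[OF has_derivative_ident], of "(X, G)"]
    by simp
  from derivative_tangent_cone_eq_0[OF this _ _ v] \<open>X ** G = 0\<close>
  show ?thesis by (auto simp: M_h_def add.commute)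
qed

text \<open>
  The counterexample is the linear function \<open>Y \<mapsto> u\<^sup>T Y v\<close> with \<open>u\<close> orthogonal to the range of \<open>X\<close> and
  \<open>v\<close> in the range of \<open>G\<close>. Such a \<open>u\<close> exists because \<open>rank X < r \<le> m\<close>, such a \<open>v\<close> because \<open>r < n\<close>.
\<close>

lemma rank_deficient_not_one_implies_one:
  fixes h :: "real^'n^'m \<Rightarrow> real^'q"
  assumes r: "r \<le> CARD('m)" "r < CARD('n)"
    and h: "smooth_on h UNIV" and inv: "orthogonally_invariant h"
    and surj: "\<forall>X \<in> zero_set h. dim (range (frechet_derivative h (at X))) = CARD('q)"
    and XG: "(X, G) \<in> M_h r h" and deficient: "rank X < r"
  shows "\<not> one_implies_one r h (X, G)"
proof
  assume "one_implies_one r h (X, G)"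
  note impl = this[unfolded one_implies_one_def, rule_format]
  have G: "G \<in> Gr (CARD('n) - r)" "X ** G = 0" "h X = 0" using XG by (auto simp: M_h_def)
  have hd: "h differentiable (at X)"
    using smooth_on_differentiable[OF h] by simp
  have "dim (range ((*v) X)) < DIM(real^'m)"
    using deficient r(1) by (simp add: rank_dim_range[symmetric])
  then obtain u where "u \<noteq> 0" and "\<And>y. y \<in> span (range ((*v) X)) \<Longrightarrow> orthogonal u y"
    using orthogonal_to_subspace_exists by metis
  then have u: "u \<noteq> 0" "u \<bullet> (X *v z) = 0" for z
    by (simp_all add: orthogonal_def span_base)
  have "G \<noteq> 0" using GrD(3)[OF G(1)] r(2) by auto
  then obtain y where y: "G *v y \<noteq> 0" by (auto simp: matrix_eq)
  define v where "v = G *v y"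
  have v: "v \<noteq> 0" "G *v v = v" "X *v v = 0"
    using y GrD(4)[OF G(1)] G(2) by (auto simp: v_def matrix_vector_mul_assoc)
  define f where "f Y = outer u v \<bullet> Y" for Y
  have fbl: "bounded_linear f" unfolding f_def by (rule bounded_linear_inner_right)
  have fC2: "Ck_on 2 f UNIV" by (rule Ck_on_linear[OF fbl open_UNIV])
  have f': "frechet_derivative f (at Y) = f" for Y
    using frechet_derivative_at[OF bounded_linear_imp_has_derivative[OF fbl]] by simp
  have fd: "f differentiable (at Y)" for Y
    using bounded_linear_imp_differentiable[OF fbl] .

  have "stationary1_reformulated r h f (X, G)"
    unfolding stationary1_reformulated_def
  proof (intro conjI XG ballI)
    fix p assume p: "p \<in> tangent_cone (M_h r h) (X, G)"
    obtain \<eta> \<zeta> where [simp]: "p = (\<eta>, \<zeta>)" by (cases p)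
    have "(\<eta> ** G + X ** \<zeta>) *v v = 0" using tangent_cone_M_h_product_rule[OF XG] p by simp
    then have "\<eta> *v v = - (X *v (\<zeta> *v v))"
      by (simp add: matrix_vector_mult_add_rdistrib v(2) eq_neg_iff_add_eq_0 flip: matrix_vector_mul_assoc)
    then have "f \<eta> = 0" using u(2) by (simp add: f_def inner_commute[of "outer u v"] inner_outer)
    then show "frechet_derivative (f \<circ> \<phi>) (at (X, G)) p = 0"
      by (simp add: derivative_comp_\<phi> fd f')
  qed
  from impl[OF fC2 this] have st: "stationary_original r h f X" by (simp add: \<phi>_def)

  define \<eta> where "\<eta> = outer (- u) v"
  have D\<eta>: "frechet_derivative h (at X) \<eta> = 0"
    unfolding \<eta>_def by (rule derivative_orthogonally_invariant_outer[OF inv hd v(3)])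
  have surjX: "dim (range (frechet_derivative h (at X))) = CARD('q)"
    using surj G(3) by (simp add: zero_set_def)
  obtain \<epsilon> Y where Y: "\<epsilon> > 0" "Y 0 = X" "(Y has_vector_derivative \<eta>) (at 0)"
    "\<And>t. t \<in> {-\<epsilon><..<\<epsilon>} \<Longrightarrow> h (Y t) = 0"
    "\<And>t z. t \<in> {-\<epsilon><..<\<epsilon>} \<Longrightarrow> X *v z = 0 \<Longrightarrow> Y t *v z = t *\<^sub>R (\<eta> *v z)"
    by (rule feasible_curve[OF h inv G(3) surjX D\<eta>]) (rule that; assumption)
  have "rank (Y t) \<le> r" if "t \<in> {-\<epsilon><..<\<epsilon>}" for t
  proof -
    \<comment> \<open>The rows of \<open>Y t\<close> lie in the span of \<open>v\<close> and the rows of \<open>X\<close>.\<close>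
    have "rank (Y t) \<le> dim (insert v (rows X))"
    proof (rule rank_le_dim_if_kernel)
      fix z assume z: "\<And>x. x \<in> insert v (rows X) \<Longrightarrow> x \<bullet> z = 0"
      then have "X *v z = 0" "v \<bullet> z = 0" by (auto simp: kernel_eq_orthogonal_rows)
      then show "Y t *v z = 0" using Y(5)[OF that] by (simp add: \<eta>_def outer_mult_vector)
    qed
    also have "\<dots> \<le> rank X + 1" by (simp add: dim_insert row_rank_def)
    finally show ?thesis using deficient by simp
  qed
  then have "\<eta> \<in> tangent_cone (bounded_rank r \<inter> zero_set h) X"
    using tangent_cone_curve[OF Y(3,1), of "bounded_rank r \<inter> zero_set h"] Y(2,4)
    by (simp add: bounded_rank_def zero_set_def)
  then have "gradient f X \<bullet> \<eta> \<ge> 0" using st unfolding stationary_original_def by blast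
  moreover have "gradient f X \<bullet> \<eta> = - ((u \<bullet> u) * (v \<bullet> v))"
    unfolding gradient_inner[OF fd] f' f_def \<eta>_def
    by (simp add: inner_commute[of "outer u v"] inner_outer) (simp add: inner_outer outer_mult_vector outer_minus)
  moreover have "(u \<bullet> u) * (v \<bullet> v) > 0" using u(1) v(1) by simp
  ultimately show False by simp
qed

section \<open>Rotations acting on \<open>M_h\<close>\<close>

text \<open>
  The orthogonal group acts on \<open>M_h\<close>: it moves the kernel of \<open>Y\<close> and the projector together.
\<close>

lemma M_h_rotate:
  fixes h :: "real^'n^'m \<Rightarrow> 'b::zero"
  assumes YG: "(Y, G) \<in> M_h r h" and inv: "orthogonally_invariant h" and Q: "orthogonal_matrix Q"
  shows "(Y ** Q, transpose Q ** G ** Q) \<in> M_h r h"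
proof -
  have G: "transpose G = G" "G ** G = G" "rank G = CARD('n) - r" "Y ** G = 0" "h Y = 0"
    using YG by (auto simp: M_h_def Gr_def)
  have QQ: "transpose Q ** Q = mat 1" "Q ** transpose Q = mat 1"
    using Q by (auto simp: orthogonal_matrix_def)
  let ?H = "transpose Q ** G ** Q"
  have cancel: "A ** Q ** transpose Q = A" for A :: "real^'n^'p"
    by (simp add: matrix_mul_assoc[symmetric] QQ(2))
  have "rank ?H \<le> rank G"
    using rank_mul_le_left[of "transpose Q ** G" Q] rank_mul_le_right[of "transpose Q" G] by simp
  moreover have "G = Q ** ?H ** transpose Q"
    by (simp add: matrix_mul_assoc QQ(2) cancel)
  then have "rank G \<le> rank ?H"
    using rank_mul_le_left[of "Q ** ?H" "transpose Q"] rank_mul_le_right[of Q ?H] by simp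
  moreover have "transpose ?H = ?H" by (simp add: matrix_transpose_mul matrix_mul_assoc G(1))
  moreover have "?H ** ?H = ?H"
    by (simp add: matrix_mul_assoc cancel) (simp add: matrix_mul_assoc[symmetric] G(2))
  moreover have "Y ** Q ** ?H = 0" by (simp add: matrix_mul_assoc cancel G(4) matrix_mult_bilinear_simps)
  moreover have "h (Y ** Q) = 0" using inv Q G(5) by (simp add: orthogonally_invariant_def)
  ultimately show ?thesis using G(3) by (simp add: M_h_def Gr_def)
qed

definition rotation_generator :: "real^'n \<Rightarrow> real^'n \<Rightarrow> real^'n^'n"
  where "rotation_generator v w = outer w v - outer v w"

definition plane_projector :: "real^'n \<Rightarrow> real^'n \<Rightarrow> real^'n^'n"
  where "plane_projector v w = outer v v + outer w w"

text \<open>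
  The exponential of \<open>s\<close> times \<open>rotation_generator v w\<close>, which for orthonormal \<open>v\<close> and \<open>w\<close> is the
  rotation of their plane by the angle \<open>s\<close>. The generator \<open>J\<close> satisfies \<open>J\<^sup>2 = - P\<close> with \<open>P\<close> the
  projector onto the plane, so the exponential series sums to this closed form.
\<close>

definition plane_rotation :: "real^'n \<Rightarrow> real^'n \<Rightarrow> real \<Rightarrow> real^'n^'n"
  where "plane_rotation v w s =
    mat 1 + sin s *\<^sub>R rotation_generator v w + (cos s - 1) *\<^sub>R plane_projector v w"

lemma plane_rotation_0 [simp]: "plane_rotation v w 0 = mat 1"
  by (simp add: plane_rotation_def)

lemma orthogonal_plane_rotation:
  assumes "norm v = 1" "norm w = 1" "v \<bullet> w = 0"
  shows "orthogonal_matrix (plane_rotation v w s)"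
proof -
  let ?J = "rotation_generator v w" and ?P = "plane_projector v w"
  have one: "v \<bullet> v = 1" "w \<bullet> w = 1" "w \<bullet> v = 0"
    using assms by (simp_all add: norm_eq_1 inner_commute)
  have mult: "?J ** ?J = - ?P" "?J ** ?P = ?J" "?P ** ?J = ?J" "?P ** ?P = ?P"
    by (simp_all add: rotation_generator_def plane_projector_def matrix_mult_bilinear_simps
        outer_mult_outer one assms(3))
  have linT: "linear (transpose :: real^'n^'n \<Rightarrow> real^'n^'n)"
    by (rule bounded_linear.linear[OF bounded_linear_transpose])
  define d where "d = cos s - 1"
  have "transpose ?J = - ?J" "transpose ?P = ?P"
    by (simp_all add: rotation_generator_def plane_projector_def linear_diff[OF linT]
        linear_add[OF linT] transpose_outer)
  then have "transpose (plane_rotation v w s) ** plane_rotation v w s =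
      (mat 1 - sin s *\<^sub>R ?J + d *\<^sub>R ?P) ** (mat 1 + sin s *\<^sub>R ?J + d *\<^sub>R ?P)"
    by (simp add: plane_rotation_def linear_add[OF linT] transpose_scalar d_def)
  also have "\<dots> = mat 1 + (2 * d + d ^ 2 + sin s ^ 2) *\<^sub>R ?P"
    by (simp only: matrix_mult_bilinear_simps mult matrix_mul_lid matrix_mul_rid vec_eq_iff)
      (simp add: algebra_simps power2_eq_square)
  also have "2 * d + d ^ 2 + sin s ^ 2 = 0"
    using sin_cos_squared_add[of s] by (simp add: d_def power2_eq_square algebra_simps)
  finally show ?thesis by (simp add: orthogonal_matrix)
qed

lemma has_vector_derivative_plane_rotation:
  "((\<lambda>t. plane_rotation v w (\<alpha> * t)) has_vector_derivative
     \<alpha> *\<^sub>R (cos (\<alpha> * t) *\<^sub>R rotation_generator v w - sin (\<alpha> * t) *\<^sub>R plane_projector v w)) (at t)"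
  unfolding plane_rotation_def
  by (auto intro!: derivative_eq_intros simp: scaleR_right_diff_distrib mult.commute)

lemma Ck_on_plane_rotation:
  assumes "open S" shows "Ck_on k (\<lambda>t. plane_rotation v w (\<alpha> * t)) S"
proof -
  have "Ck_on k (\<lambda>t. sin (\<alpha> * t) *\<^sub>R rotation_generator v w) S"
    using Ck_on_bounded_linear[OF bounded_linear_scaleR_left assms Ck_on_sin_cos[OF assms, of k 0 \<alpha> 1]]
    by simp
  moreover have "Ck_on k (\<lambda>t. (cos (\<alpha> * t) - 1) *\<^sub>R plane_projector v w) S"
    using Ck_on_bounded_linear[OF bounded_linear_scaleR_left assms
        Ck_on_add[OF assms Ck_on_sin_cos[OF assms, of k 1 \<alpha> 0] Ck_on_const[OF assms, of k "-1"]]]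
    by simp
  ultimately show ?thesis
    unfolding plane_rotation_def
    using Ck_on_add[OF assms Ck_on_add[OF assms Ck_on_const[OF assms]]] by blast
qed

section \<open>Second-order stationarity at rank-deficient points\<close>

text \<open>
  The curve is \<open>t \<mapsto> (Y(t) Q(\<alpha> t), Q(\<alpha> t)\<^sup>T G Q(\<alpha> t))\<close>, where \<open>Y\<close> is feasible with velocity
  \<open>\<eta> = u w\<^sup>T\<close> and \<open>Q\<close> rotates the plane of \<open>v\<close> and \<open>w\<close>. As \<open>X\<close> vanishes on this plane, the rotation does
  not show in the velocity; it contributes \<open>2 \<alpha> \<eta> J = 2 \<alpha> u v\<^sup>T\<close> to the acceleration. So the second
  derivative of \<open>f\<close> is affine in \<open>\<alpha>\<close>, and an affine function bounded below on the reals is constant.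
\<close>

lemma derivative_along_moving_kernel_eq_0:
  fixes h :: "real^'n^'m \<Rightarrow> real^'q" and f :: "real^'n^'m \<Rightarrow> real"
  assumes h: "smooth_on h UNIV" and inv: "orthogonally_invariant h"
    and surj: "dim (range (frechet_derivative h (at X))) = CARD('q)"
    and XG: "(X, G) \<in> M_h r h"
    and f: "Ck_on 2 f UNIV" and st: "stationary2_reformulated r h f (X, G)"
    and v: "norm v = 1" "G *v v = v" and w: "norm w = 1" "X *v w = 0" "G *v w = 0"
  shows "frechet_derivative f (at X) (outer u v) = 0"
proof -
  have G: "G \<in> Gr (CARD('n) - r)" "X ** G = 0" "h X = 0" using XG by (auto simp: M_h_def)
  have GG: "(G *v x) \<bullet> y = x \<bullet> (G *v y)" for x y
    using GrD(1)[OF G(1)] by (metis dot_lmul_matrix transpose_matrix_vector)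
  have Xv: "X *v v = 0" by (metis v(2) G(2) matrix_vector_mul_assoc matrix_vector_mult_0)
  have vw: "v \<bullet> w = 0" using GG[of v w] v(2) w(3) by simp
  have fd: "f differentiable (at X)" using f by (simp add: numeral_2_eq_2 Ck_on_Suc)
  interpret D: linear "frechet_derivative f (at X)"
    using fd has_derivative_linear frechet_derivative_works by blast
  define \<eta> where "\<eta> = outer u w"
  have D\<eta>: "frechet_derivative h (at X) \<eta> = 0"
    unfolding \<eta>_def
    by (rule derivative_orthogonally_invariant_outer[OF inv smooth_on_differentiable[OF h UNIV_I] w(2)])
  obtain \<epsilon> Y where \<epsilon>: "\<epsilon> > 0" and smY: "smooth_on Y {-\<epsilon><..<\<epsilon>}" and Y0: "Y 0 = X"
    and Y': "(Y has_vector_derivative \<eta>) (at 0)"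
    and hY: "\<And>t. t \<in> {-\<epsilon><..<\<epsilon>} \<Longrightarrow> h (Y t) = 0"
    and Yz: "\<And>t z. t \<in> {-\<epsilon><..<\<epsilon>} \<Longrightarrow> X *v z = 0 \<Longrightarrow> Y t *v z = t *\<^sub>R (\<eta> *v z)"
    by (rule feasible_curve[OF h inv G(3) surj D\<eta>]) (rule that; assumption)
  define T where "T = {-\<epsilon><..<\<epsilon>}"
  have T: "open T" "0 \<in> T" using \<epsilon> by (auto simp: T_def)
  have CkY: "Ck_on k Y T" for k using smY by (simp add: smooth_on_def T_def)
  have YG: "(Y t, G) \<in> M_h r h" if "t \<in> T" for t
  proof -
    have "Y t *v (G *v z) = 0" for z
    proof -
      have "w \<bullet> (G *v z) = 0" using GG[of w z] w(3) by simp
      moreover have "X *v (G *v z) = 0" by (simp add: matrix_vector_mul_assoc G(2))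
      ultimately show ?thesis
        using Yz[of t "G *v z"] that by (simp add: T_def \<eta>_def outer_mult_vector)
    qed
    then have "Y t ** G = 0" by (simp add: matrix_eq matrix_vector_mul_assoc)
    then show ?thesis using G(1) hY that by (simp add: M_h_def T_def)
  qed
  define Y1 where "Y1 t = frechet_derivative Y (at t) 1" for t
  have derY: "(Y has_vector_derivative Y1 t) (at t)" if "t \<in> T" for t
  proof -
    have D: "(Y has_derivative frechet_derivative Y (at t)) (at t)"
      using Ck_on_Suc_has_derivative[OF CkY that] .
    have "frechet_derivative Y (at t) = (\<lambda>s. s *\<^sub>R Y1 t)"
    proof
      show "frechet_derivative Y (at t) s = s *\<^sub>R Y1 t" for s
        using linear_scale[OF has_derivative_linear[OF D], of s 1]
        by (simp only: Y1_def real_scaleR_def mult_1_right)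
    qed
    then show ?thesis using D by (simp add: has_vector_derivative_def)
  qed
  have Y10: "Y1 0 = \<eta>" using vector_derivative_unique_at[OF derY[OF T(2)] Y'] .
  have "Ck_on (Suc 0) Y1 T" using CkY[of "Suc (Suc 0)"] unfolding Y1_def Ck_on_Suc[of "Suc 0"] by blast
  then have "Y1 differentiable (at 0)" using T(2) by (simp add: Ck_on_Suc)
  \<comment> \<open>The acceleration of the feasible curve; it does not involve \<open>\<alpha>\<close> and is absorbed into \<open>c\<close>.\<close>
  define Y2 where "Y2 = vector_derivative Y1 (at 0)"
  have Y2: "(Y1 has_vector_derivative Y2) (at 0)"
    unfolding Y2_def using \<open>Y1 differentiable (at 0)\<close> by (rule vector_derivative_works[THEN iffD1])

  let ?J = "rotation_generator v w" and ?P = "plane_projector v w"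
  have XJ: "X ** ?J = 0" "X ** ?P = 0" "\<eta> ** ?J = outer u v"
    using v(1) w(1) vw
    by (simp_all add: rotation_generator_def plane_projector_def \<eta>_def matrix_mult_bilinear_simps
        mult_outer Xv w(2) outer_mult_vector norm_eq_1 inner_commute)
  define c where "c = frechet_derivative f (at X) Y2 +
    (\<Sum>b\<in>Basis. (\<eta> \<bullet> b) * frechet_derivative (\<lambda>y. frechet_derivative f (at y) b) (at X) \<eta>)"
  have nonneg: "c + 2 * \<alpha> * frechet_derivative f (at X) (outer u v) \<ge> 0" for \<alpha>
  proof -
    define Q where "Q t = plane_rotation v w (\<alpha> * t)" for t
    define Q1 where "Q1 t = \<alpha> *\<^sub>R (cos (\<alpha> * t) *\<^sub>R ?J - sin (\<alpha> * t) *\<^sub>R ?P)" for t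
    have Q: "(Q has_vector_derivative Q1 t) (at t)" for t
      unfolding Q_def Q1_def by (rule has_vector_derivative_plane_rotation)
    have Q1: "(Q1 has_vector_derivative - (\<alpha> ^ 2) *\<^sub>R ?P) (at 0)"
      unfolding Q1_def by (auto intro!: derivative_eq_intros simp: power2_eq_square)
    have Q0: "Q 0 = mat 1" "Q1 0 = \<alpha> *\<^sub>R ?J" by (simp_all add: Q_def Q1_def)
    have CkQ: "Ck_on k Q T" for k unfolding Q_def by (rule Ck_on_plane_rotation[OF T(1)])
    define \<gamma> where "\<gamma> t = (Y t ** Q t, transpose (Q t) ** G ** Q t)" for t
    have "Ck_on k \<gamma> T" for k
      unfolding \<gamma>_def
      by (rule Ck_on_Pair[OF T(1) Ck_on_bilinear[OF bounded_bilinear_matrix_mult T(1) CkY CkQ]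
            Ck_on_bilinear[OF bounded_bilinear_matrix_mult T(1)
              Ck_on_bilinear[OF bounded_bilinear_matrix_mult T(1)
                Ck_on_bounded_linear[OF bounded_linear_transpose T(1) CkQ] Ck_on_const[OF T(1)]] CkQ]])
    moreover have "\<gamma> t \<in> M_h r h" if "t \<in> T" for t
      unfolding \<gamma>_def Q_def
      by (rule M_h_rotate[OF YG[OF that] inv orthogonal_plane_rotation[OF v(1) w(1) vw]])
    moreover have "\<gamma> 0 = (X, G)" by (simp add: \<gamma>_def Y0 Q0)
    ultimately have "smooth_curve_at (M_h r h) (X, G) \<gamma>"
      using \<epsilon> unfolding smooth_curve_at_def smooth_on_def T_def by blast
    then have "deriv (deriv (f \<circ> \<phi> \<circ> \<gamma>)) 0 \<ge> 0"
      using st unfolding stationary2_reformulated_def by blast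
    also have "f \<circ> \<phi> \<circ> \<gamma> = (\<lambda>t. f (Y t ** Q t))" by (simp add: fun_eq_iff \<phi>_def \<gamma>_def)
    also have "deriv (deriv (\<lambda>t. f (Y t ** Q t))) 0 = c + 2 * \<alpha> * frechet_derivative f (at X) (outer u v)"
    proof -
      note der_mult = bounded_bilinear.has_vector_derivative[OF bounded_bilinear_matrix_mult]
      have "deriv (deriv (\<lambda>t. f (Y t ** Q t))) 0 =
          frechet_derivative f (at (Y 0 ** Q 0)) ((Y 0 ** (- (\<alpha> ^ 2) *\<^sub>R ?P) + Y1 0 ** Q1 0) + (Y1 0 ** Q1 0 + Y2 ** Q 0)) +
          (\<Sum>b\<in>Basis. ((Y 0 ** Q1 0 + Y1 0 ** Q 0) \<bullet> b) *
            frechet_derivative (\<lambda>y. frechet_derivative f (at y) b) (at (Y 0 ** Q 0)) (Y 0 ** Q1 0 + Y1 0 ** Q 0))"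
        by (rule second_derivative_along_curve[OF f T])
          (intro has_vector_derivative_add der_mult derY Q Q1 Y2 T(2); assumption)+
      moreover have "(Y 0 ** (- (\<alpha> ^ 2) *\<^sub>R ?P) + Y1 0 ** Q1 0) + (Y1 0 ** Q1 0 + Y2 ** Q 0) =
          (2 * \<alpha>) *\<^sub>R outer u v + Y2"
        by (simp add: Y0 Y10 Q0 matrix_mult_bilinear_simps XJ) (simp add: vec_eq_iff)
      moreover have "Y 0 ** Q1 0 + Y1 0 ** Q 0 = \<eta>" "Y 0 ** Q 0 = X"
        by (simp_all add: Y0 Y10 Q0 matrix_mult_bilinear_simps XJ)
      ultimately have "deriv (deriv (\<lambda>t. f (Y t ** Q t))) 0 =
          frechet_derivative f (at X) ((2 * \<alpha>) *\<^sub>R outer u v + Y2) +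
          (\<Sum>b\<in>Basis. (\<eta> \<bullet> b) * frechet_derivative (\<lambda>y. frechet_derivative f (at y) b) (at X) \<eta>)"
        by (simp only:)
      then show ?thesis by (simp add: c_def D.add D.scale)
    qed
    finally show ?thesis .
  qed
  show ?thesis
  proof (rule ccontr)
    let ?d = "frechet_derivative f (at X) (outer u v)"
    assume "?d \<noteq> 0"
    then have "2 * (- (\<bar>c\<bar> + 1) / (2 * ?d)) * ?d = - (\<bar>c\<bar> + 1)" by simp
    with nonneg[of "- (\<bar>c\<bar> + 1) / (2 * ?d)"] show False by linarith
  qed
qed

text \<open>
  Split \<open>\<eta> = \<eta> G + (\<eta> - \<eta> G)\<close>. The first part is a sum of matrices \<open>u v\<^sup>T\<close> with \<open>v\<close> in the range of
  \<open>G\<close>, which the second-order condition handles. The second part is annihilated by \<open>G\<close> and still in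
  the kernel of \<open>D h\<close>, so it is the velocity of a feasible curve along which \<open>G\<close> can stay fixed, and
  the first-order condition applies.
\<close>

lemma derivative_eq_0_if_rank_deficient:
  fixes h :: "real^'n^'m \<Rightarrow> real^'q" and f :: "real^'n^'m \<Rightarrow> real"
  assumes r: "r \<le> CARD('n)"
    and h: "smooth_on h UNIV" and inv: "orthogonally_invariant h"
    and surj: "dim (range (frechet_derivative h (at X))) = CARD('q)"
    and XG: "(X, G) \<in> M_h r h" and deficient: "rank X < r"
    and f: "Ck_on 2 f UNIV" and st: "stationary2_reformulated r h f (X, G)"
    and \<eta>: "frechet_derivative h (at X) \<eta> = 0"
  shows "frechet_derivative f (at X) \<eta> = 0"
proof -
  have G: "G \<in> Gr (CARD('n) - r)" "X ** G = 0" "h X = 0" using XG by (auto simp: M_h_def)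
  note g = GrD[OF G(1)]
  let ?Df = "frechet_derivative f (at X)" and ?Dh = "frechet_derivative h (at X)"
  have fd: "f differentiable (at X)" using f by (simp add: numeral_2_eq_2 Ck_on_Suc)
  have hd: "h differentiable (at X)" by (rule smooth_on_differentiable[OF h UNIV_I])
  interpret Df: linear ?Df using fd has_derivative_linear frechet_derivative_works by blast
  interpret Dh: linear ?Dh using hd has_derivative_linear frechet_derivative_works by blast
  have "rank X + rank G < CARD('n)" using deficient r g(3) by linarith
  then obtain w where w: "norm w = 1" "X *v w = 0" "G *v w = 0"
    by (rule common_kernel_nontrivial)
  have outer: "?Df (outer u (G *v z)) = 0" for u z
  proof (cases "G *v z = 0")
    case True
    then show ?thesis by (simp add: outer_def vec_eq_iff flip: zero_vec_def) 
  next
    case False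
    define v where "v = (G *v z) /\<^sub>R norm (G *v z)"
    have "norm v = 1" "G *v v = v" using False by (simp_all add: v_def matrix_vector_mult_scaleR g(4))
    then have "?Df (outer (norm (G *v z) *\<^sub>R u) v) = 0"
      by (rule derivative_along_moving_kernel_eq_0[OF h inv surj XG f st _ _ w])
    moreover have "outer (norm (G *v z) *\<^sub>R u) v = outer u (G *v z)"
      using False by (simp add: v_def outer_def vec_eq_iff)
    ultimately show ?thesis by simp
  qed
  have "?Df (\<eta> ** G) = 0"
  proof -
    have "\<eta> ** G = (\<Sum>i\<in>UNIV. outer (axis i 1) (G *v (\<eta> $ i)))"
    proof -
      have "G $ i $ j = G $ j $ i" for i j
        using arg_cong[OF g(1), of "\<lambda>A. A $ j $ i"] by (simp add: transpose_def)
      then show ?thesis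
        by (simp add: vec_eq_iff outer_def axis_def matrix_matrix_mult_def matrix_vector_mult_def
            if_distrib[of "\<lambda>x. x * _"] sum.delta mult.commute cong: if_cong)
    qed
    then show ?thesis by (simp add: Df.sum outer)
  qed
  moreover have "?Df (\<eta> - \<eta> ** G) = 0"
  proof -
    let ?\<xi> = "\<eta> - \<eta> ** G"
    have "?Dh ?\<xi> = 0"
      using \<eta> derivative_orthogonally_invariant_projector[OF inv hd g(1,2) G(2)] by (simp add: Dh.diff)
    then obtain \<epsilon> Y where \<epsilon>: "\<epsilon> > 0" and Y0: "Y 0 = X" and Y': "(Y has_vector_derivative ?\<xi>) (at 0)"
      and hY: "\<And>t. t \<in> {-\<epsilon><..<\<epsilon>} \<Longrightarrow> h (Y t) = 0"
      and Yz: "\<And>t z. t \<in> {-\<epsilon><..<\<epsilon>} \<Longrightarrow> X *v z = 0 \<Longrightarrow> Y t *v z = t *\<^sub>R (?\<xi> *v z)"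
      by (rule feasible_curve[OF h inv G(3) surj]) (rule that; assumption)
    have "(Y t, G) \<in> M_h r h" if "t \<in> {-\<epsilon><..<\<epsilon>}" for t
    proof -
      have "?\<xi> ** G = 0" by (simp add: matrix_mult_bilinear_simps g(2) flip: matrix_mul_assoc)
      then have "?\<xi> *v (G *v z) = 0" for z by (simp add: matrix_vector_mul_assoc)
      moreover have "X *v (G *v z) = 0" for z by (simp add: matrix_vector_mul_assoc G(2))
      ultimately have "Y t *v (G *v z) = 0" for z using Yz[OF that] by simp
      then have "Y t ** G = 0" by (simp add: matrix_eq matrix_vector_mul_assoc)
      then show ?thesis using G(1) hY[OF that] by (simp add: M_h_def)
    qed
    moreover have "((\<lambda>t. (Y t, G)) has_vector_derivative (?\<xi>, 0)) (at 0)"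
      by (rule has_vector_derivative_Pair[OF Y' has_vector_derivative_const])
    ultimately have "(?\<xi>, 0) \<in> tangent_cone (M_h r h) (X, G)"
      using tangent_cone_curve[of "\<lambda>t. (Y t, G)" "(?\<xi>, 0)" \<epsilon> "M_h r h"] \<epsilon> Y0 by simp
    then have "frechet_derivative (f \<circ> \<phi>) (at (X, G)) (?\<xi>, 0) = 0"
      using st unfolding stationary2_reformulated_def stationary1_reformulated_def by blast
    then show ?thesis using derivative_comp_\<phi>[of f "(X, G)"] fd by simp
  qed
  ultimately show ?thesis using Df.add[of "\<eta> ** G" "\<eta> - \<eta> ** G"] by simp
qed

lemma two_implies_one_rank_deficient:
  fixes h :: "real^'n^'m \<Rightarrow> real^'q"
  assumes r: "r \<le> CARD('n)"
    and h: "smooth_on h UNIV" and inv: "orthogonally_invariant h"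
    and surj: "dim (range (frechet_derivative h (at X))) = CARD('q)"
    and XG: "(X, G) \<in> M_h r h" and deficient: "rank X < r"
  shows "two_implies_one r h (X, G)"
  unfolding two_implies_one_def
proof (intro allI impI)
  fix f :: "real^'n^'m \<Rightarrow> real"
  assume f: "Ck_on 2 f UNIV" and st: "stationary2_reformulated r h f (X, G)"
  have fd: "f differentiable (at X)" using f by (simp add: numeral_2_eq_2 Ck_on_Suc)
  have hD: "(h has_derivative frechet_derivative h (at X)) (at X)"
    using smooth_on_differentiable[OF h UNIV_I] by (simp add: frechet_derivative_works)
  have "stationary_original r h f X"
  proof (rule stationary_originalI[OF XG r fd])
    fix \<eta> assume "\<eta> \<in> tangent_cone (bounded_rank r \<inter> zero_set h) X"
    then have "frechet_derivative h (at X) \<eta> = 0"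
      using XG by (intro derivative_tangent_cone_eq_0[OF hD]) (auto simp: zero_set_def M_h_def)
    then show "frechet_derivative f (at X) \<eta> \<ge> 0"
      using derivative_eq_0_if_rank_deficient[OF r h inv surj XG deficient f st] by simp
  qed
  then show "stationary_original r h f (\<phi> (X, G))" by (simp add: \<phi>_def)
qed

section \<open>When stationarity transfers to the original problem\<close>

theorem theorem3:
  fixes h :: "real^'n^'m \<Rightarrow> real^'q" and r :: nat
  assumes "r \<le> min CARD('m) CARD('n)"
    and "smooth_on h UNIV"
    and "orthogonally_invariant h"
    and "\<forall>X \<in> zero_set h. dim (range (frechet_derivative h (at X))) = CARD('q)"
  shows "(\<forall>(X, G) \<in> M_h r h.
            (rank X = r \<longrightarrow> one_implies_one r h (X, G)) \<and>
            (r < CARD('n) \<longrightarrow> one_implies_one r h (X, G) \<longrightarrow> rank X = r)) \<and>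
         (\<forall>(X, G) \<in> M_h r h. two_implies_one r h (X, G))"
proof -
  have r: "r \<le> CARD('m)" "r \<le> CARD('n)" using assms(1) by auto
  have surj: "dim (range (frechet_derivative h (at X))) = CARD('q)" if "(X, G) \<in> M_h r h" for X G
    using assms(4) that by (auto simp: M_h_def zero_set_def)
  have full: "one_implies_one r h (X, G)" if "(X, G) \<in> M_h r h" "rank X = r" for X G
    using one_implies_one_full_rank that by metis
  have "rank X = r" if "(X, G) \<in> M_h r h" "r < CARD('n)" "one_implies_one r h (X, G)" for X G
    using rank_deficient_not_one_implies_one[OF r(1) that(2) assms(2-4) that(1)] that(3)
      rank_le_if_M_h[OF that(1) r(2)] by linarith
  moreover have "two_implies_one r h (X, G)" if XG: "(X, G) \<in> M_h r h" for X G
  proof (cases "rank X = r")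
    case True
    then show ?thesis
      using full[OF XG] unfolding one_implies_one_def two_implies_one_def stationary2_reformulated_def
      by blast
  next
    case False
    then have "rank X < r" using rank_le_if_M_h[OF XG r(2)] by simp
    then show ?thesis
      by (rule two_implies_one_rank_deficient[OF r(2) assms(2,3) surj[OF XG] XG])
  qed
  ultimately show ?thesis using full by blast
qed

end
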